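(* Let $(\mathcal{A},\omega_0)$ be a (non-unital) non-commutative measure space and $(\mathcal{B},\tau)$ a non-commutative probability space, with $\mathcal{B}=1\cdot\mathbb{C}\oplus\ker(\tau)=:1\cdot\mathbb{C}\oplus\mathring{\mathcal{B}}$. Let $\omega=\omega_0\trianglerighteq\tau$ be the cyclic monotone product and $\tilde\omega=\omega_0\triangleright\tau$ the monotone product of $\omega_0$ and $\tau$, and let $I$, $J$, $\mathrm{End}_{\mathrm{fin}}(\mathcal{B})$, $\mathrm{Tr}$ and $\psi$ be as defined in the context. Then the ideal $J$ annihilates $\omega$ and $\tilde\omega$ (that is, $\omega$ and $\tilde\omega$ vanish on $J$), and there is a canonical map $$\chi: I\to I/J\cong\mathcal{B}\otimes\mathrm{D}(\omega_0)\otimes\mathcal{B}\cong\mathrm{D}(\omega_0)\otimes\mathrm{End}_{\mathrm{fin}}(\mathcal{B}),$$ which satisfies the following two properties: $$(\omega_0\otimes\mathrm{Tr})\circ\chi=\omega\qquad\text{and}\qquad(\omega_0\otimes\psi)\circ\chi=\tilde\omega.$$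
   Context: A non-commutative measure space is a pair $(\mathcal{A},\omega)$ where $\mathcal{A}$ is a (unital or non-unital) $\ast$-algebra over $\mathbb{C}$ and $\omega$ is a tracial weight: a linear functional defined on a (possibly non-unital) $\ast$-subalgebra $\mathrm{D}(\omega)$ of $\mathcal{A}$ with $\omega(a^*a)\ge0$, $\omega(a^* )=\overline{\omega(a)}$ and $\omega(ab)=\omega(ba)$ for all $a,b\in\mathrm{D}(\omega)$. If moreover $\mathcal{A}$ is unital, $\mathrm{D}(\omega)=\mathcal{A}$ and $\omega(1_{\mathcal{A}})=1$, it is called a non-commutative probability space. Let $\mathcal{A}*\mathcal{B}$ be the free product $\ast$-algebra; this free product does not amalgamate over the unit (there is no unit in $\mathcal{A}$), and $\mathcal{A}*\mathcal{B}$ is unital. Set $$I=\mathrm{D}(\omega_0)\oplus(\mathrm{D}(\omega_0)\otimes\mathring{\mathcal{B}})\oplus(\mathring{\mathcal{B}}\otimes\mathrm{D}(\omega_0))\oplus(\mathring{\mathcal{B}}\otimes\mathrm{D}(\omega_0)\otimes\mathring{\mathcal{B}})\oplus J,\qquad J=(\mathrm{D}(\omega_0)\otimes\mathring{\mathcal{B}}\otimes\mathrm{D}(\omega_0))\oplus\cdots,$$ where $J$ is the sum of all the remaining alternating tensor products of copies of $\mathrm{D}(\omega_0)$ and $\mathring{\mathcal{B}}$, i.e. those with at least two legs $\mathrm{D}(\omega_0)$ (so at least three legs in total and at least one leg $\mathring{\mathcal{B}}$). Then $I$ is an ideal in $\mathcal{A}*\mathcal{B}$, and $J$ is an ideal in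 $I$. The products $\omega$ and $\tilde\omega$ are the linear functionals with domain $\mathrm{D}(\omega)=\mathrm{D}(\tilde\omega)=I$ determined, for $n\ge1$, $a_1,\dots,a_n\in\mathrm{D}(\omega_0)$ and $b_0,\dots,b_n\in\mathcal{B}$, by $$\omega(b_0a_1b_1\cdots a_nb_n)=\omega_0(a_1\cdots a_n)\,\tau(b_1)\cdots\tau(b_{n-1})\,\tau(b_nb_0),$$ $$\tilde\omega(b_0a_1b_1\cdots a_nb_n)=\omega_0(a_1\cdots a_n)\,\tau(b_0)\tau(b_1)\cdots\tau(b_n).$$ $\mathrm{End}_{\mathrm{fin}}(\mathcal{B})$ is the collection of finite rank endomorphisms of the vector space $\mathcal{B}$; as a vector space it is canonically isomorphic to $\mathcal{B}^*\otimes\mathcal{B}$. $\mathrm{Tr}$ is the usual (non-normalized) trace on it, and $\psi$ is the linear extension of $\psi(h_1^*\otimes h_2)=h_1^*(1)\,\tau(h_2)$. The map $\chi$ is the quotient map $I\to I/J$ followed by the displayed isomorphisms, which are given by the identifications $\mathrm{D}(\omega_0)\cong1_{\mathcal{B}}\otimes\mathrm{D}(\omega_0)\otimes1_{\mathcal{B}}$, $\mathrm{D}(\omega_0)\otimes\mathring{\mathcal{B}}\cong1_{\mathcal{B}}\otimes\mathrm{D}(\omega_0)\otimes\mathring{\mathcal{B}}$, $\mathring{\mathcal{B}}\otimes\mathrm{D}(\omega_0)\cong\mathring{\mathcal{B}}\otimes\mathrm{D}(\omega_0)\otimes1_{\mathcal{B}}$, and the usual identification $\mathcal{B}\otimes\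mathcal{B}\cong\mathrm{End}_{\mathrm{fin}}(\mathcal{B})$.
   Formalization: The second isomorphism, B⊗D(ω₀)⊗B ≅ D(ω₀)⊗End_fin(B), fails in general; it is stated as a canonical linear map, injective if τ is faithful and bijective if moreover B is finite-dimensional. All other claims hold for every τ. *)

theory Defs
  imports Complex_Main "HOL-Library.Poly_Mapping" "HOL-Library.FuncSet" "HOL-Library.Nonpos_Ints"
begin

section \<open>Complex vector spaces and $*$-algebras\<close>

class scaleC =
  fixes scaleC :: "complex \<Rightarrow> 'a \<Rightarrow> 'a" (infixr "*\<^sub>C" 75)

class complex_vector = scaleC + ab_group_add +
  assumes scaleC_add_right: "a *\<^sub>C (x + y) = a *\<^sub>C x + a *\<^sub>C y"
    and scaleC_add_left: "(a + b) *\<^sub>C x = a *\<^sub>C x + b *\<^sub>C x"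
    and scaleC_scaleC: "a *\<^sub>C (b *\<^sub>C x) = (a * b) *\<^sub>C x"
    and scaleC_one: "1 *\<^sub>C x = x"

global_interpretation cvec: vector_space "scaleC :: complex \<Rightarrow> 'a \<Rightarrow> 'a::complex_vector"
  by unfold_locales (fact scaleC_add_right scaleC_add_left scaleC_scaleC scaleC_one)+

class complex_star_algebra = complex_vector + ring +
  fixes star :: "'a \<Rightarrow> 'a"
  assumes mult_scaleC_left: "(c *\<^sub>C x) * y = c *\<^sub>C (x * y)"
    and mult_scaleC_right: "x * (c *\<^sub>C y) = c *\<^sub>C (x * y)"
    and star_add: "star (x + y) = star x + star y"
    and star_scaleC: "star (c *\<^sub>C x) = cnj c *\<^sub>C star x"
    and star_mult: "star (x * y) = star y * star x"
    and star_star: "star (star x) = x"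

class unital_complex_star_algebra = complex_star_algebra + ring_1

instantiation complex :: complex_vector
begin
definition scaleC_complex :: "complex \<Rightarrow> complex \<Rightarrow> complex"
  where "scaleC_complex c z = c * z"
instance by standard (simp_all add: scaleC_complex_def algebra_simps)
end

definition linear_on :: "'v::complex_vector set \<Rightarrow> ('v \<Rightarrow> 'w::complex_vector) \<Rightarrow> bool" where
  "linear_on S f \<longleftrightarrow>
     (\<forall>x\<in>S. \<forall>y\<in>S. f (x + y) = f x + f y) \<and> (\<forall>c. \<forall>x\<in>S. f (c *\<^sub>C x) = c *\<^sub>C f x)"

definition star_subalgebra :: "'a::complex_star_algebra set \<Rightarrow> bool" where
  "star_subalgebra D \<longleftrightarrow>
     cvec.subspace D \<and> (\<forall>x\<in>D. \<forall>y\<in>D. x * y \<in> D) \<and> (\<forall>x\<in>D. star x \<in> D)"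

definition is_ideal_of :: "'a::complex_star_algebra set \<Rightarrow> 'a set \<Rightarrow> bool" where
  "is_ideal_of J I \<longleftrightarrow> J \<subseteq> I \<and> cvec.subspace J \<and> (\<forall>x\<in>J. \<forall>y\<in>I. x * y \<in> J \<and> y * x \<in> J)"

section \<open>Non-commutative measure and probability spaces\<close>

text \<open>A weight with domain \<open>D\<close> is a total HOL function whose values outside \<open>D\<close> are irrelevant.\<close>

definition nc_measure_space :: "'a::complex_star_algebra set \<Rightarrow> ('a \<Rightarrow> complex) \<Rightarrow> bool" where
  "nc_measure_space D \<omega> \<longleftrightarrow>
     star_subalgebra D \<and> linear_on D \<omega> \<and>
     (\<forall>a\<in>D. \<omega> (star a * a) \<in> \<real>\<^sub>\<ge>\<^sub>0) \<and>
     (\<forall>a\<in>D. \<omega> (star a) = cnj (\<omega> a)) \<and>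
     (\<forall>a\<in>D. \<forall>b\<in>D. \<omega> (a * b) = \<omega> (b * a))"

definition nc_probability_space :: "('b::unital_complex_star_algebra \<Rightarrow> complex) \<Rightarrow> bool" where
  "nc_probability_space \<tau> \<longleftrightarrow> nc_measure_space UNIV \<tau> \<and> \<tau> 1 = 1"

text \<open>
  Faithfulness makes \<open>h \<mapsto> \<tau> (h \<cdot>)\<close> an injection of \<open>\<B>\<close> into its dual; it is onto exactly when
  moreover \<open>\<B>\<close> has finite dimension.
\<close>

definition faithful :: "('b::unital_complex_star_algebra \<Rightarrow> complex) \<Rightarrow> bool" where
  "faithful \<tau> \<longleftrightarrow> (\<forall>b. \<tau> (star b * b) = 0 \<longrightarrow> b = 0)"

section \<open>Tensor products\<close>

text \<open>The free vector space on pairs modulo the bilinearity relations.\<close>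

instantiation poly_mapping :: (type, complex_vector) complex_vector
begin
definition scaleC_poly_mapping :: "complex \<Rightarrow> ('a \<Rightarrow>\<^sub>0 'b) \<Rightarrow> ('a \<Rightarrow>\<^sub>0 'b)"
  where "scaleC_poly_mapping c p = Poly_Mapping.map (scaleC c) p"
lemma lookup_scaleC: "Poly_Mapping.lookup (c *\<^sub>C p) k = c *\<^sub>C Poly_Mapping.lookup p k"
  for p :: "'a \<Rightarrow>\<^sub>0 'b"
  unfolding scaleC_poly_mapping_def by (simp add: map.rep_eq when_def)
instance
  by standard
    (rule poly_mapping_eqI, simp add: lookup_scaleC lookup_add scaleC_add_right scaleC_add_left
      scaleC_scaleC scaleC_one)+
end

definition bilinearity_relations ::
    "(('v::complex_vector \<times> 'w::complex_vector) \<Rightarrow>\<^sub>0 complex) set" where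
  "bilinearity_relations = cvec.span (
     {Poly_Mapping.single (v + v', w) 1 - Poly_Mapping.single (v, w) 1
        - Poly_Mapping.single (v', w) 1 | v v' w. True} \<union>
     {Poly_Mapping.single (v, w + w') 1 - Poly_Mapping.single (v, w) 1
        - Poly_Mapping.single (v, w') 1 | v w w'. True} \<union>
     {Poly_Mapping.single (c *\<^sub>C v, w) 1 - c *\<^sub>C Poly_Mapping.single (v, w) 1 | c v w. True} \<union>
     {Poly_Mapping.single (v, c *\<^sub>C w) 1 - c *\<^sub>C Poly_Mapping.single (v, w) 1 | c v w. True})"

definition tensor_eq ::
    "('v::complex_vector \<times> 'w::complex_vector \<Rightarrow>\<^sub>0 complex) \<Rightarrow> ('v \<times> 'w \<Rightarrow>\<^sub>0 complex) \<Rightarrow> bool" where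
  "tensor_eq p q \<longleftrightarrow> p - q \<in> bilinearity_relations"

lemma subspace_bilinearity_relations: "cvec.subspace bilinearity_relations"
  unfolding bilinearity_relations_def by (rule cvec.subspace_span)

quotient_type (overloaded) ('v, 'w) tensor =
  "('v::complex_vector \<times> 'w::complex_vector) \<Rightarrow>\<^sub>0 complex" / tensor_eq
proof (rule equivpI)
  show "reflp tensor_eq"
    by (simp add: reflp_def tensor_eq_def cvec.subspace_0[OF subspace_bilinearity_relations])
  show "symp tensor_eq"
    by (rule sympI, unfold tensor_eq_def)
      (drule cvec.subspace_neg[OF subspace_bilinearity_relations], simp)
  show "transp tensor_eq"
    by (rule transpI, unfold tensor_eq_def)
      (drule (1) cvec.subspace_add[OF subspace_bilinearity_relations], simp)
qed

instantiation tensor :: (complex_vector, complex_vector) complex_vector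
begin
lift_definition zero_tensor :: "('a, 'b) tensor" is 0 .
lift_definition plus_tensor :: "('a, 'b) tensor \<Rightarrow> ('a, 'b) tensor \<Rightarrow> ('a, 'b) tensor" is "(+)"
  unfolding tensor_eq_def
  by (drule (1) cvec.subspace_add[OF subspace_bilinearity_relations]) (simp add: algebra_simps)
lift_definition uminus_tensor :: "('a, 'b) tensor \<Rightarrow> ('a, 'b) tensor" is uminus
  unfolding tensor_eq_def
  by (drule cvec.subspace_neg[OF subspace_bilinearity_relations]) (simp add: algebra_simps)
lift_definition minus_tensor :: "('a, 'b) tensor \<Rightarrow> ('a, 'b) tensor \<Rightarrow> ('a, 'b) tensor" is "(-)"
  unfolding tensor_eq_def
  by (drule (1) cvec.subspace_diff[OF subspace_bilinearity_relations]) (simp add: algebra_simps)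
lift_definition scaleC_tensor :: "complex \<Rightarrow> ('a, 'b) tensor \<Rightarrow> ('a, 'b) tensor" is scaleC
  unfolding tensor_eq_def
  by (drule cvec.subspace_scale[OF subspace_bilinearity_relations])
    (simp add: cvec.scale_right_diff_distrib)
instance
  by standard
    (transfer; simp add: tensor_eq_def cvec.subspace_0[OF subspace_bilinearity_relations]
      scaleC_add_right scaleC_add_left scaleC_scaleC scaleC_one algebra_simps)+
end

lift_definition pure_tensor ::
    "'v::complex_vector \<Rightarrow> 'w::complex_vector \<Rightarrow> ('v, 'w) tensor" (infixr "\<otimes>" 72)
  is "\<lambda>v w. Poly_Mapping.single (v, w) 1" .

text \<open>
  For subspaces \<open>V\<close> and \<open>W\<close> the space \<open>V \<otimes> W\<close> is realised inside the tensor product of the ambient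
  spaces; over a field the canonical map between the two is injective.
\<close>

definition tensor_subspace ::
    "'v::complex_vector set \<Rightarrow> 'w::complex_vector set \<Rightarrow> ('v, 'w) tensor set" where
  "tensor_subspace V W = cvec.span {v \<otimes> w | v w. v \<in> V \<and> w \<in> W}"

text \<open>The functional \<open>f \<otimes> g\<close> on \<open>V \<otimes> W\<close>.\<close>

definition tensor_functional ::
    "'v::complex_vector set \<Rightarrow> 'w::complex_vector set \<Rightarrow> ('v \<Rightarrow> complex) \<Rightarrow> ('w \<Rightarrow> complex)
      \<Rightarrow> ('v, 'w) tensor \<Rightarrow> complex" where
  "tensor_functional V W f g = (THE h. h \<in> extensional (tensor_subspace V W) \<and>
     linear_on (tensor_subspace V W) h \<and> (\<forall>v\<in>V. \<forall>w\<in>W. h (v \<otimes> w) = f v * g w))"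

section \<open>The free product\<close>

text \<open>
  The free product of a (not necessarily unital) $*$-algebra \<open>\<A>\<close> and a unital $*$-algebra \<open>\<B>\<close>, by
  generators and relations: \<open>free_product_eq\<close> is the least congruence that makes the terms a
  $*$-algebra with unit \<open>1\<close> of \<open>\<B>\<close> and both inclusions $*$-homomorphisms. A unit that \<open>\<A>\<close> may
  happen to have is not identified with it.
\<close>

datatype ('a, 'b) fp_term =
    Left 'a | Right 'b | Add "('a, 'b) fp_term" "('a, 'b) fp_term"
  | Mul "('a, 'b) fp_term" "('a, 'b) fp_term" | Scale complex "('a, 'b) fp_term"
  | Star "('a, 'b) fp_term"

inductive free_product_eq ::
    "('a::complex_star_algebra, 'b::unital_complex_star_algebra) fp_term \<Rightarrow> ('a, 'b) fp_term \<Rightarrow> bool"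
    (infix "\<approx>" 50) where
  fp_refl: "t \<approx> t"
| fp_sym: "t \<approx> u \<Longrightarrow> u \<approx> t"
| fp_trans: "t \<approx> u \<Longrightarrow> u \<approx> v \<Longrightarrow> t \<approx> v"
| fp_Add: "t \<approx> t' \<Longrightarrow> u \<approx> u' \<Longrightarrow> Add t u \<approx> Add t' u'"
| fp_Mul: "t \<approx> t' \<Longrightarrow> u \<approx> u' \<Longrightarrow> Mul t u \<approx> Mul t' u'"
| fp_Scale: "t \<approx> t' \<Longrightarrow> Scale c t \<approx> Scale c t'"
| fp_Star: "t \<approx> t' \<Longrightarrow> Star t \<approx> Star t'"
| fp_add_assoc: "Add (Add t u) v \<approx> Add t (Add u v)"
| fp_add_commute: "Add t u \<approx> Add u t"
| fp_add_zero: "Add (Right 0) t \<approx> t"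
| fp_add_neg: "Add (Scale (-1) t) t \<approx> Right 0"
| fp_mul_assoc: "Mul (Mul t u) v \<approx> Mul t (Mul u v)"
| fp_distrib_right: "Mul (Add t u) v \<approx> Add (Mul t v) (Mul u v)"
| fp_distrib_left: "Mul t (Add u v) \<approx> Add (Mul t u) (Mul t v)"
| fp_one_left: "Mul (Right 1) t \<approx> t"
| fp_one_right: "Mul t (Right 1) \<approx> t"
| fp_scale_add: "Scale c (Add t u) \<approx> Add (Scale c t) (Scale c u)"
| fp_add_scale: "Scale (c + d) t \<approx> Add (Scale c t) (Scale d t)"
| fp_scale_scale: "Scale c (Scale d t) \<approx> Scale (c * d) t"
| fp_scale_one: "Scale 1 t \<approx> t"
| fp_mul_scale_left: "Mul (Scale c t) u \<approx> Scale c (Mul t u)"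
| fp_mul_scale_right: "Mul t (Scale c u) \<approx> Scale c (Mul t u)"
| fp_star_add: "Star (Add t u) \<approx> Add (Star t) (Star u)"
| fp_star_scale: "Star (Scale c t) \<approx> Scale (cnj c) (Star t)"
| fp_star_mul: "Star (Mul t u) \<approx> Mul (Star u) (Star t)"
| fp_star_star: "Star (Star t) \<approx> t"
| fp_Left_add: "Left (a + a') \<approx> Add (Left a) (Left a')"
| fp_Left_scale: "Left (c *\<^sub>C a) \<approx> Scale c (Left a)"
| fp_Left_mul: "Left (a * a') \<approx> Mul (Left a) (Left a')"
| fp_Left_star: "Left (star a) \<approx> Star (Left a)"
| fp_Right_add: "Right (b + b') \<approx> Add (Right b) (Right b')"
| fp_Right_scale: "Right (c *\<^sub>C b) \<approx> Scale c (Right b)"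
| fp_Right_mul: "Right (b * b') \<approx> Mul (Right b) (Right b')"
| fp_Right_star: "Right (star b) \<approx> Star (Right b)"

definition star_hom :: "('a::complex_star_algebra \<Rightarrow> 'c::complex_star_algebra) \<Rightarrow> bool" where
  "star_hom f \<longleftrightarrow> linear_on UNIV f \<and> (\<forall>x y. f (x * y) = f x * f y) \<and> (\<forall>x. f (star x) = star (f x))"

primrec fp_eval :: "('a \<Rightarrow> 'c) \<Rightarrow> ('b \<Rightarrow> 'c) \<Rightarrow> ('a, 'b) fp_term \<Rightarrow> 'c::complex_star_algebra" where
  "fp_eval f g (Left a) = f a"
| "fp_eval f g (Right b) = g b"
| "fp_eval f g (Add t u) = fp_eval f g t + fp_eval f g u"
| "fp_eval f g (Mul t u) = fp_eval f g t * fp_eval f g u"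
| "fp_eval f g (Scale c t) = c *\<^sub>C fp_eval f g t"
| "fp_eval f g (Star t) = star (fp_eval f g t)"

lemma fp_eval_cong:
  fixes f :: "'a::complex_star_algebra \<Rightarrow> 'c::unital_complex_star_algebra"
    and g :: "'b::unital_complex_star_algebra \<Rightarrow> 'c"
  assumes f: "star_hom f" and g: "star_hom g" "g 1 = 1" and "t \<approx> u"
  shows "fp_eval f g t = fp_eval f g u"
proof -
  have g0: "g 0 = 0"
    using g(1) unfolding star_hom_def linear_on_def by (metis UNIV_I add_cancel_right_left)
  show ?thesis
    using \<open>t \<approx> u\<close>
    by (induction rule: free_product_eq.induct)
      (use f g in \<open>simp_all add: g0 star_hom_def linear_on_def algebra_simps mult_scaleC_left
        mult_scaleC_right star_add star_scaleC star_mult star_star scaleC_add_right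
        scaleC_add_left scaleC_scaleC scaleC_one\<close>)
qed

quotient_type (overloaded) ('a, 'b) free_product =
  "('a::complex_star_algebra, 'b::unital_complex_star_algebra) fp_term" / free_product_eq
  by (rule equivpI) (auto simp: reflp_def symp_def transp_def intro: fp_refl fp_sym fp_trans)

instantiation free_product ::
  (complex_star_algebra, unital_complex_star_algebra) unital_complex_star_algebra
begin
lift_definition zero_free_product :: "('a, 'b) free_product" is "Right 0" .
lift_definition one_free_product :: "('a, 'b) free_product" is "Right 1" .
lift_definition plus_free_product ::
  "('a, 'b) free_product \<Rightarrow> ('a, 'b) free_product \<Rightarrow> ('a, 'b) free_product" is Add by (rule fp_Add)
lift_definition uminus_free_product ::
  "('a, 'b) free_product \<Rightarrow> ('a, 'b) free_product" is "Scale (-1)" by (rule fp_Scale)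
lift_definition minus_free_product ::
  "('a, 'b) free_product \<Rightarrow> ('a, 'b) free_product \<Rightarrow> ('a, 'b) free_product"
  is "\<lambda>t u. Add t (Scale (-1) u)" by (intro fp_Add fp_Scale)
lift_definition times_free_product ::
  "('a, 'b) free_product \<Rightarrow> ('a, 'b) free_product \<Rightarrow> ('a, 'b) free_product" is Mul by (rule fp_Mul)
lift_definition scaleC_free_product ::
  "complex \<Rightarrow> ('a, 'b) free_product \<Rightarrow> ('a, 'b) free_product" is Scale by (rule fp_Scale)
lift_definition star_free_product ::
  "('a, 'b) free_product \<Rightarrow> ('a, 'b) free_product" is Star by (rule fp_Star)

instance
proof
  show "(0 :: ('a, 'b) free_product) \<noteq> 1"
  proof transfer
    have "star_hom (\<lambda>_::'a. 0 :: 'b)"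
      unfolding star_hom_def linear_on_def
      by (simp, metis add_cancel_right_left star_add)
    moreover have "star_hom (\<lambda>b::'b. b)"
      unfolding star_hom_def linear_on_def by simp
    ultimately show "\<not> (Right 0 :: ('a, 'b) fp_term) \<approx> Right 1"
      using fp_eval_cong[of "\<lambda>_::'a. 0 :: 'b" "\<lambda>b. b" "Right 0" "Right 1"] by auto
  qed
qed (transfer; rule fp_refl fp_add_assoc fp_add_commute fp_add_zero fp_add_neg fp_mul_assoc
      fp_distrib_right fp_distrib_left fp_one_left fp_one_right fp_scale_add fp_add_scale
      fp_scale_scale fp_scale_one fp_mul_scale_left fp_mul_scale_right fp_star_add fp_star_scale
      fp_star_mul fp_star_star)+
end

lift_definition incl_A :: "'a \<Rightarrow> ('a::complex_star_algebra, 'b::unital_complex_star_algebra) free_product"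
  is Left .
lift_definition incl_B :: "'b \<Rightarrow> ('a::complex_star_algebra, 'b::unital_complex_star_algebra) free_product"
  is Right .

theorem free_product_universal_property:
  fixes f :: "'a::complex_star_algebra \<Rightarrow> 'c::unital_complex_star_algebra"
    and g :: "'b::unital_complex_star_algebra \<Rightarrow> 'c"
  assumes "star_hom f" "star_hom g" "g 1 = 1"
  shows "\<exists>!h :: ('a, 'b) free_product \<Rightarrow> 'c.
    star_hom h \<and> (\<forall>a. h (incl_A a) = f a) \<and> (\<forall>b. h (incl_B b) = g b)"
proof
  note cong = fp_eval_cong[OF assms]
  define h :: "('a, 'b) free_product \<Rightarrow> 'c" where "h x = fp_eval f g (rep_free_product x)" for x
  have h_abs: "h (abs_free_product t) = fp_eval f g t" for t
    unfolding h_def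
    by (rule cong) (simp add: Quotient3_rep_abs[OF Quotient3_free_product] fp_refl)
  have "h (x + y) = h x + h y" "h (c *\<^sub>C x) = c *\<^sub>C h x" "h (x * y) = h x * h y"
    "h (star x) = star (h x)" for x y c
    by (induct x, induct y, simp add: h_abs plus_free_product.abs_eq scaleC_free_product.abs_eq
      times_free_product.abs_eq star_free_product.abs_eq)+
  then show "star_hom h \<and> (\<forall>a. h (incl_A a) = f a) \<and> (\<forall>b. h (incl_B b) = g b)"
    by (simp add: star_hom_def linear_on_def incl_A.abs_eq incl_B.abs_eq h_abs)
  fix k :: "('a, 'b) free_product \<Rightarrow> 'c"
  assume k: "star_hom k \<and> (\<forall>a. k (incl_A a) = f a) \<and> (\<forall>b. k (incl_B b) = g b)"
  have "k (abs_free_product t) = fp_eval f g t" for t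
    by (induct t)
      (use k in \<open>auto simp: star_hom_def linear_on_def incl_A.abs_eq incl_B.abs_eq
        plus_free_product.abs_eq[symmetric] scaleC_free_product.abs_eq[symmetric]
        times_free_product.abs_eq[symmetric] star_free_product.abs_eq[symmetric]\<close>)
  then show "k = h"
    using h_abs by (intro ext) (metis Quotient3_abs_rep[OF Quotient3_free_product])
qed

no_notation free_product_eq (infix "\<approx>" 50)

section \<open>The spaces $I$ and $J$\<close>

fun incl_leg :: "'a + 'b \<Rightarrow> ('a::complex_star_algebra, 'b::unital_complex_star_algebra) free_product"
  where "incl_leg (Inl a) = incl_A a" | "incl_leg (Inr b) = incl_B b"

definition ring_B :: "('b::unital_complex_star_algebra \<Rightarrow> complex) \<Rightarrow> 'b set" where
  "ring_B \<tau> = {b. \<tau> b = 0}"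

definition alternating :: "('a + 'b) list \<Rightarrow> bool" where
  "alternating w \<longleftrightarrow> (\<forall>i. Suc i < length w \<longrightarrow> isl (w ! i) \<noteq> isl (w ! Suc i))"

definition legs_in :: "'a set \<Rightarrow> 'b set \<Rightarrow> ('a + 'b) list \<Rightarrow> bool" where
  "legs_in D C w \<longleftrightarrow> set w \<subseteq> D <+> C"

text \<open>
  In the free product the elementary tensor with given legs is the product of the legs, and the
  alternating tensor products of \<open>\<A>\<close> and \<open>ring_B \<tau>\<close> are linearly independent subspaces. So \<open>J\<close> and
  \<open>I\<close> are the spans of the corresponding products.
\<close>

definition J_space :: "'a::complex_star_algebra set \<Rightarrow> ('b::unital_complex_star_algebra \<Rightarrow> complex)
    \<Rightarrow> ('a, 'b) free_product set" where
  "J_space D \<tau> = cvec.span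
     {prod_list (map incl_leg w) | w.
        alternating w \<and> legs_in D (ring_B \<tau>) w \<and> 2 \<le> length (filter isl w)}"

definition I_space :: "'a::complex_star_algebra set \<Rightarrow> ('b::unital_complex_star_algebra \<Rightarrow> complex)
    \<Rightarrow> ('a, 'b) free_product set" where
  "I_space D \<tau> = cvec.span (
     {incl_A a | a. a \<in> D} \<union>
     {incl_A a * incl_B b | a b. a \<in> D \<and> b \<in> ring_B \<tau>} \<union>
     {incl_B b * incl_A a | b a. b \<in> ring_B \<tau> \<and> a \<in> D} \<union>
     {incl_B b * incl_A a * incl_B b' | b a b'. b \<in> ring_B \<tau> \<and> a \<in> D \<and> b' \<in> ring_B \<tau>} \<union>
     J_space D \<tau>)"

section \<open>The monotone and cyclic monotone products\<close>

text \<open>The product of a nonempty list; a non-unital algebra has no empty product.\<close>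

fun nonempty_prod :: "'a::semigroup_mult list \<Rightarrow> 'a" where
  "nonempty_prod [x] = x"
| "nonempty_prod (x # y # zs) = x * nonempty_prod (y # zs)"

text \<open>The element $b_0 a_1 b_1 \cdots a_n b_n$.\<close>

definition mixed_product :: "nat \<Rightarrow> (nat \<Rightarrow> 'a) \<Rightarrow> (nat \<Rightarrow> 'b)
    \<Rightarrow> ('a::complex_star_algebra, 'b::unital_complex_star_algebra) free_product" where
  "mixed_product n a b = incl_B (b 0) * (\<Prod>i\<leftarrow>[1..<Suc n]. incl_A (a i) * incl_B (b i))"

definition cyclic_monotone_product ::
    "'a::complex_star_algebra set \<Rightarrow> ('a \<Rightarrow> complex) \<Rightarrow> ('b::unital_complex_star_algebra \<Rightarrow> complex)
      \<Rightarrow> ('a, 'b) free_product \<Rightarrow> complex" where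
  "cyclic_monotone_product D \<omega>0 \<tau> = (THE \<omega>. \<omega> \<in> extensional (I_space D \<tau>) \<and>
     linear_on (I_space D \<tau>) \<omega> \<and>
     (\<forall>n\<ge>1. \<forall>a b. (\<forall>i\<in>{1..n}. a i \<in> D) \<longrightarrow>
        \<omega> (mixed_product n a b) =
          \<omega>0 (nonempty_prod (map a [1..<Suc n])) * (\<Prod>i\<in>{1..<n}. \<tau> (b i)) * \<tau> (b n * b 0)))"

definition monotone_product ::
    "'a::complex_star_algebra set \<Rightarrow> ('a \<Rightarrow> complex) \<Rightarrow> ('b::unital_complex_star_algebra \<Rightarrow> complex)
      \<Rightarrow> ('a, 'b) free_product \<Rightarrow> complex" where
  "monotone_product D \<omega>0 \<tau> = (THE \<omega>. \<omega> \<in> extensional (I_space D \<tau>) \<and>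
     linear_on (I_space D \<tau>) \<omega> \<and>
     (\<forall>n\<ge>1. \<forall>a b. (\<forall>i\<in>{1..n}. a i \<in> D) \<longrightarrow>
        \<omega> (mixed_product n a b) =
          \<omega>0 (nonempty_prod (map a [1..<Suc n])) * (\<Prod>i\<in>{0..n}. \<tau> (b i))))"

section \<open>Finite rank endomorphisms\<close>

definition finite_rank :: "('b::complex_vector \<Rightarrow> 'b) \<Rightarrow> bool" where
  "finite_rank T \<longleftrightarrow> (\<exists>F. finite F \<and> range T \<subseteq> cvec.span F)"

lemma finite_rank_zero: "finite_rank (\<lambda>_. 0)"
  unfolding finite_rank_def by (rule exI[of _ "{}"]) simp

lemma finite_rank_add:
  assumes "finite_rank S" "finite_rank T" shows "finite_rank (\<lambda>x. S x + T x)"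
proof -
  obtain F G where F: "finite F" "range S \<subseteq> cvec.span F" and G: "finite G" "range T \<subseteq> cvec.span G"
    using assms unfolding finite_rank_def by metis
  have "S x + T x \<in> cvec.span (F \<union> G)" for x
  proof (rule cvec.span_add)
    show "S x \<in> cvec.span (F \<union> G)"
      using F(2) cvec.span_mono[of F "F \<union> G"] by blast
    show "T x \<in> cvec.span (F \<union> G)"
      using G(2) cvec.span_mono[of G "F \<union> G"] by blast
  qed
  then have "range (\<lambda>x. S x + T x) \<subseteq> cvec.span (F \<union> G)"
    by (rule image_subsetI)
  moreover have "finite (F \<union> G)"
    using F(1) G(1) by simp
  ultimately show ?thesis
    unfolding finite_rank_def by metis
qed

lemma finite_rank_scaleC:
  assumes "finite_rank T" shows "finite_rank (\<lambda>x. c *\<^sub>C T x)"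
proof -
  obtain F where F: "finite F" "range T \<subseteq> cvec.span F"
    using assms unfolding finite_rank_def by metis
  have "c *\<^sub>C T x \<in> cvec.span F" for x
    by (rule cvec.span_scale) (use F(2) in blast)
  then have "range (\<lambda>x. c *\<^sub>C T x) \<subseteq> cvec.span F"
    by (rule image_subsetI)
  with F(1) show ?thesis
    unfolding finite_rank_def by metis
qed

typedef (overloaded) 'b end_fin = "{T :: 'b::complex_vector \<Rightarrow> 'b. linear_on UNIV T \<and> finite_rank T}"
  morphisms apply_endo Abs_end_fin
proof
  show "(\<lambda>_. 0) \<in> {T :: 'b \<Rightarrow> 'b. linear_on UNIV T \<and> finite_rank T}"
    by (simp add: linear_on_def finite_rank_zero)
qed

setup_lifting type_definition_end_fin

instantiation end_fin :: (complex_vector) complex_vector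
begin
lift_definition zero_end_fin :: "'a end_fin" is "\<lambda>_. 0"
  by (simp add: linear_on_def finite_rank_zero)
lift_definition scaleC_end_fin :: "complex \<Rightarrow> 'a end_fin \<Rightarrow> 'a end_fin" is "\<lambda>c T x. c *\<^sub>C T x"
  by (simp add: finite_rank_scaleC linear_on_def scaleC_add_right scaleC_scaleC mult.commute)
lift_definition plus_end_fin :: "'a end_fin \<Rightarrow> 'a end_fin \<Rightarrow> 'a end_fin" is "\<lambda>S T x. S x + T x"
  by (simp add: finite_rank_add linear_on_def scaleC_add_right algebra_simps)
definition uminus_end_fin :: "'a end_fin \<Rightarrow> 'a end_fin" where "uminus_end_fin T = (-1) *\<^sub>C T"
definition minus_end_fin :: "'a end_fin \<Rightarrow> 'a end_fin \<Rightarrow> 'a end_fin"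
  where "minus_end_fin S T = S + (-1) *\<^sub>C T"
instance
  by standard
    (simp_all add: uminus_end_fin_def minus_end_fin_def,
      (transfer; simp add: algebra_simps scaleC_add_right scaleC_add_left scaleC_scaleC scaleC_one)+)
end

text \<open>
  The element of \<open>End\<^sub>f\<^sub>i\<^sub>n(\<B>)\<close> that corresponds to \<open>f \<otimes> h\<close> in \<open>\<B>\<^sup>* \<otimes> \<B>\<close>; only meaningful for linear \<open>f\<close>.
\<close>

definition rank_one :: "('b \<Rightarrow> complex) \<Rightarrow> 'b \<Rightarrow> 'b::complex_vector end_fin" where
  "rank_one f h = Abs_end_fin (\<lambda>x. f x *\<^sub>C h)"

text \<open>
  The sum of the diagonal entries in a Hamel basis; only finitely many of them are nonzero.
\<close>

definition Tr :: "'b::complex_vector end_fin \<Rightarrow> complex" where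
  "Tr T = (let B = cvec.extend_basis {} in
     \<Sum>b | b \<in> B \<and> cvec.representation B (apply_endo T b) b \<noteq> 0.
       cvec.representation B (apply_endo T b) b)"

definition psi :: "('b::unital_complex_star_algebra \<Rightarrow> complex) \<Rightarrow> 'b end_fin \<Rightarrow> complex" where
  "psi \<tau> = (THE p. linear_on UNIV p \<and>
     (\<forall>f h. linear_on UNIV f \<longrightarrow> p (rank_one f h) = f 1 * \<tau> h))"

section \<open>Quotients\<close>

definition coset :: "'v::complex_vector set \<Rightarrow> 'v \<Rightarrow> 'v set" where
  "coset J x = {x + y | y. y \<in> J}"

definition quotient_space :: "'v::complex_vector set \<Rightarrow> 'v set \<Rightarrow> 'v set set" where
  "quotient_space I J = coset J ` I"

text \<open>
  A map on the cosets is linear for the quotient structure iff its composition with the quotient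
  map is linear on \<open>I\<close>.
\<close>

definition quotient_iso ::
    "'v::complex_vector set \<Rightarrow> 'v set \<Rightarrow> ('v set \<Rightarrow> 'w) \<Rightarrow> 'w::complex_vector set \<Rightarrow> bool" where
  "quotient_iso I J \<Phi> W \<longleftrightarrow>
     bij_betw \<Phi> (quotient_space I J) W \<and> linear_on I (\<lambda>x. \<Phi> (coset J x))"

end

theory Submission
  imports Defs "HOL-Library.Product_Plus"
begin

text \<open>
  Everything follows from one linear map \<open>X\<close> on the whole free product with
  \[ X (b_0 a_1 b_1 \cdots a_n b_n) = \tau(b_1) \cdots \tau(b_{n-1}) \;
     b_0 \otimes a_1 \cdots a_n \otimes b_n \qquad (n \ge 1). \]
  It comes from a module. Let \<open>b\<close> act on \<open>\<B> \<otimes> \<A> \<otimes> \<B>\<close> by multiplication of the first leg and let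
  \<open>a\<close> send \<open>h \<otimes> a' \<otimes> k\<close> to \<open>\<tau>(h) 1 \<otimes> a a' \<otimes> k\<close>; since \<open>\<tau>(1) = 1\<close>, this respects products in \<open>\<A>\<close>.
  Add a summand \<open>\<B>\<close> on which \<open>b\<close> acts by multiplication and \<open>a\<close> sends \<open>k\<close> to \<open>1 \<otimes> a \<otimes> k\<close> in the
  first summand. By \<open>free_product_representation\<close> the two actions define one of \<open>\<A> * \<B>\<close>, and
  \<open>X x\<close> is the component in \<open>\<B> \<otimes> \<A> \<otimes> \<B>\<close> of \<open>x\<close> applied to the unit of the summand \<open>\<B>\<close>
  (\<open>collapse_map\<close>).

  A product \<open>a b a'\<close> with \<open>\<tau>(b) = 0\<close> acts as zero, and each spanning word of \<open>J\<close> contains such a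
  factor; hence \<open>X\<close> vanishes on \<open>J\<close>. Conversely, every \<open>x\<close> in \<open>I\<close> agrees modulo \<open>J\<close> with the element
  obtained from \<open>X x\<close> by \<open>h \<otimes> a \<otimes> k \<mapsto> h a k\<close>. So \<open>J\<close> is the kernel of \<open>X\<close> on \<open>I\<close>, and \<open>X\<close> induces the
  isomorphism \<open>I / J \<cong> \<B> \<otimes> D \<otimes> \<B>\<close> (\<open>collapse_kernel_image\<close>).

  The mixed products \<open>b\<^sub>0 a\<^sub>1 b\<^sub>1 \<dots> a\<^sub>n b\<^sub>n\<close> lie in \<open>I\<close> and span it. Therefore the two defining
  formulas determine functionals on \<open>I\<close>, and the formula for \<open>X\<close> shows that these are the
  compositions of \<open>X\<close> with \<open>h \<otimes> a \<otimes> k \<mapsto> \<omega>\<^sub>0(a) \<tau>(k h)\<close> and with \<open>h \<otimes> a \<otimes> k \<mapsto> \<omega>\<^sub>0(a) \<tau>(h) \<tau>(k)\<close>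
  (\<open>product_functional_eq\<close>). Under \<open>h \<otimes> a \<otimes> k \<mapsto> a \<otimes> \<tau>(h \<cdot>) k\<close> these two are \<open>\<omega>\<^sub>0 \<otimes> Tr\<close> and
  \<open>\<omega>\<^sub>0 \<otimes> \<psi>\<close>, because the rank one operator \<open>\<tau>(h \<cdot>) k\<close> has trace \<open>\<tau>(h k) = \<tau>(k h)\<close> and
  \<open>\<psi>\<close>-value \<open>\<tau>(h) \<tau>(k)\<close>. In particular both products vanish on \<open>J\<close>.

  The ideal property is a statement about words: for \<open>m \<ge> 1\<close> the span of the alternating words with
  at least \<open>m\<close> legs in \<open>D\<close> is stable under multiplication by \<open>\<B>\<close> and by \<open>D\<close>: one more leg is
  either adjoined to a word or multiplied into its outermost leg, and the multiple of the unit that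
  a leg in \<open>\<B>\<close> may contain only rescales the word; no leg in \<open>D\<close> is lost.
  The spaces \<open>I\<close> and \<open>J\<close> are the cases \<open>m = 1\<close> and \<open>m = 2\<close>.
\<close>

section \<open>Complex-linear maps\<close>

global_interpretation cvec_pair: vector_space_pair
    "scaleC :: complex \<Rightarrow> 'v \<Rightarrow> 'v::complex_vector" "scaleC :: complex \<Rightarrow> 'w \<Rightarrow> 'w::complex_vector" ..

abbreviation clinear :: "('v::complex_vector \<Rightarrow> 'w::complex_vector) \<Rightarrow> bool" where
  "clinear f \<equiv> linear_on UNIV f"

lemma clinear_iff_linear: "clinear f \<longleftrightarrow> Vector_Spaces.linear scaleC scaleC f"
  by (simp add: linear_on_def Vector_Spaces.linear_iff cvec.vector_space_axioms)

lemma clinearI: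
  "(\<And>x y. f (x + y) = f x + f y) \<Longrightarrow> (\<And>c x. f (c *\<^sub>C x) = c *\<^sub>C f x) \<Longrightarrow> clinear f"
  by (simp add: linear_on_def)

lemma clinear_add: "clinear f \<Longrightarrow> f (x + y) = f x + f y"
  and clinear_scale: "clinear f \<Longrightarrow> f (c *\<^sub>C x) = c *\<^sub>C f x"
  by (simp_all add: linear_on_def)

lemma clinear_0: "clinear f \<Longrightarrow> f 0 = 0"
  unfolding clinear_iff_linear by (rule cvec_pair.linear_0)

lemma clinear_diff: "clinear f \<Longrightarrow> f (x - y) = f x - f y"
  unfolding clinear_iff_linear by (rule cvec_pair.linear_diff)

lemma clinear_sum: "clinear f \<Longrightarrow> f (sum g S) = (\<Sum>x\<in>S. f (g x))"
  unfolding clinear_iff_linear by (rule cvec_pair.linear_sum)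

lemma linear_on_mono: "linear_on T f \<Longrightarrow> S \<subseteq> T \<Longrightarrow> linear_on S f"
  unfolding linear_on_def by blast

lemma linear_on_eq_on_span:
  assumes "cvec.subspace S" "B \<subseteq> S" "linear_on S f" "linear_on S g"
    and "\<And>x. x \<in> B \<Longrightarrow> f x = g x" and "x \<in> cvec.span B"
  shows "f x = g x"
proof -
  have "cvec.subspace {x \<in> S. f x = g x}"
  proof (rule cvec.subspaceI)
    have "f (0 *\<^sub>C 0) = 0 *\<^sub>C f 0" "g (0 *\<^sub>C 0) = 0 *\<^sub>C g 0"
      using assms(1,3,4) cvec.subspace_0[OF assms(1)] unfolding linear_on_def by blast+
    then show "0 \<in> {x \<in> S. f x = g x}"
      using cvec.subspace_0[OF assms(1)] by simp
  qed (use assms(1,3,4) in \<open>auto simp: linear_on_def cvec.subspace_add cvec.subspace_scale\<close>)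
  then have "cvec.span B \<subseteq> {x \<in> S. f x = g x}"
    by (rule cvec.span_minimal[rotated]) (use assms(2,5) in auto)
  then show ?thesis using assms(6) by blast
qed

lemma clinear_image_span_subset:
  assumes "clinear f" "\<And>x. x \<in> B \<Longrightarrow> f x \<in> cvec.span C" "x \<in> cvec.span B"
  shows "f x \<in> cvec.span C"
proof -
  have "cvec.subspace {x. f x \<in> cvec.span C}"
    by (rule cvec.subspaceI)
      (use assms(1) in \<open>auto simp: clinear_0 clinear_add clinear_scale cvec.span_zero cvec.span_add cvec.span_scale\<close>)
  then have "cvec.span B \<subseteq> {x. f x \<in> cvec.span C}"
    by (rule cvec.span_minimal[rotated]) (use assms(2) in auto)
  then show ?thesis using assms(3) by blast
qed

text \<open>
  A weight is linear on its domain alone, whereas maps out of the tensor product of the ambient spaces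
  need functionals that are linear everywhere; a Hamel basis of the domain provides them.
\<close>

lemma linear_on_extension:
  fixes f :: "'v::complex_vector \<Rightarrow> 'w::complex_vector"
  assumes "cvec.subspace S" "linear_on S f"
  obtains g where "clinear g" "\<And>x. x \<in> S \<Longrightarrow> g x = f x"
proof -
  obtain B where B: "B \<subseteq> S" "cvec.independent B" "S \<subseteq> cvec.span B"
    using cvec.maximal_independent_subset by blast
  obtain g where g: "clinear g" "\<And>x. x \<in> B \<Longrightarrow> g x = f x"
    using cvec_pair.linear_independent_extend[OF B(2), of f] unfolding clinear_iff_linear by blast
  have "g x = f x" if "x \<in> S" for x
    using linear_on_eq_on_span[OF assms(1) B(1) linear_on_mono[OF g(1)] assms(2) g(2)] that B(3) by blast
  with g(1) show thesis by (rule that)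
qed

section \<open>Linear maps out of tensor products\<close>

lemma pure_tensor_add_left: "(v + v') \<otimes> w = v \<otimes> w + v' \<otimes> w"
  by transfer (unfold tensor_eq_def bilinearity_relations_def diff_diff_eq[symmetric], rule cvec.span_base, blast)

lemma pure_tensor_add_right: "v \<otimes> (w + w') = v \<otimes> w + v \<otimes> w'"
  by transfer (unfold tensor_eq_def bilinearity_relations_def diff_diff_eq[symmetric], rule cvec.span_base, blast)

lemma pure_tensor_scale_left: "(c *\<^sub>C v) \<otimes> w = c *\<^sub>C (v \<otimes> w)"
  by transfer (unfold tensor_eq_def bilinearity_relations_def, rule cvec.span_base, blast)

lemma pure_tensor_scale_right: "v \<otimes> (c *\<^sub>C w) = c *\<^sub>C (v \<otimes> w)"
  by transfer (unfold tensor_eq_def bilinearity_relations_def, rule cvec.span_base, blast)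

lemma clinear_pure_tensor_right: "clinear (\<lambda>w. v \<otimes> w)"
  and clinear_pure_tensor_left: "clinear (\<lambda>v. v \<otimes> w)"
  by (auto intro!: clinearI simp: pure_tensor_add_right pure_tensor_scale_right
      pure_tensor_add_left pure_tensor_scale_left)

lemma pure_tensor_zero_left [simp]: "0 \<otimes> w = 0"
  and pure_tensor_zero_right [simp]: "v \<otimes> 0 = 0"
  using clinear_0[OF clinear_pure_tensor_left] clinear_0[OF clinear_pure_tensor_right] by blast+

text \<open>
  The element of the free vector space as a combination of its generators; its image in the tensor
  product shows that the pure tensors span.
\<close>

lemma poly_mapping_eq_sum_single:
  fixes p :: "'k \<Rightarrow>\<^sub>0 complex"
  shows "p = (\<Sum>k\<in>Poly_Mapping.keys p. Poly_Mapping.lookup p k *\<^sub>C Poly_Mapping.single k 1)"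
  by (rule poly_mapping_eqI)
    (simp add: lookup_sum lookup_scaleC lookup_single when_def scaleC_complex_def
      in_keys_iff if_distrib[of "\<lambda>x. _ * x"] cong: if_cong)

lemma abs_tensor_sum: "abs_tensor (sum f S) = (\<Sum>x\<in>S. abs_tensor (f x))"
  by (induction S rule: infinite_finite_induct)
    (simp_all add: plus_tensor.abs_eq[symmetric] zero_tensor_def)

lemma span_pure_tensors: "cvec.span (range (\<lambda>(v, w). v \<otimes> w)) = UNIV"
proof -
  have "t \<in> cvec.span (range (\<lambda>(v, w). v \<otimes> w))" for t :: "('a, 'b) tensor"
  proof (induction t)
    fix p :: "('a \<times> 'b) \<Rightarrow>\<^sub>0 complex"
    have single: "abs_tensor (Poly_Mapping.single k 1) = fst k \<otimes> snd k" for k :: "'a \<times> 'b"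
      by (simp add: pure_tensor_def)
    have "abs_tensor p = (\<Sum>k\<in>Poly_Mapping.keys p. Poly_Mapping.lookup p k *\<^sub>C (fst k \<otimes> snd k))"
      by (subst poly_mapping_eq_sum_single)
        (simp add: abs_tensor_sum scaleC_tensor.abs_eq[symmetric] single)
    also have "\<dots> \<in> cvec.span (range (\<lambda>(v, w). v \<otimes> w))"
      by (intro cvec.span_sum cvec.span_scale cvec.span_base) (auto intro: rev_image_eqI)
    finally show "abs_tensor p \<in> cvec.span (range (\<lambda>(v, w). v \<otimes> w))" .
  qed
  then show ?thesis by blast
qed

lemma clinear_eq_on_pure_tensors:
  assumes "clinear f" "clinear g" "\<And>v w. f (v \<otimes> w) = g (v \<otimes> w)"
  shows "f t = g t"
  by (rule linear_on_eq_on_span[OF cvec.subspace_UNIV _ assms(1,2), of "range (\<lambda>(v, w). v \<otimes> w)"])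
    (auto simp: assms(3) span_pure_tensors)

definition cbilinear where
  "cbilinear f \<longleftrightarrow> (\<forall>v. clinear (f v)) \<and> (\<forall>w. clinear (\<lambda>v. f v w))"

text \<open>
  The linear map that the universal property assigns to a bilinear \<open>f\<close>, computed on a representative
  in the free vector space on pairs.
\<close>

definition tensor_lift ::
    "('v::complex_vector \<Rightarrow> 'w::complex_vector \<Rightarrow> 'u::complex_vector) \<Rightarrow> ('v, 'w) tensor \<Rightarrow> 'u" where
  "tensor_lift f t = (let p = rep_tensor t in
     \<Sum>k\<in>Poly_Mapping.keys p. Poly_Mapping.lookup p k *\<^sub>C f (fst k) (snd k))"

text \<open>
  For bilinear \<open>f\<close> the linear extension \<open>E\<close> of \<open>f\<close> to the free vector space on pairs vanishes on the
  bilinearity relations, so the value is the same for all representatives.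
\<close>

lemma
  fixes f :: "'a::complex_vector \<Rightarrow> 'b::complex_vector \<Rightarrow> 'c::complex_vector"
  assumes f: "cbilinear f"
  shows clinear_tensor_lift: "clinear (tensor_lift f)"
    and tensor_lift_pure: "tensor_lift f (v \<otimes> w) = f v w"
proof -
  define E where "E p = (\<Sum>k\<in>Poly_Mapping.keys p. Poly_Mapping.lookup p k *\<^sub>C f (fst k) (snd k))"
    for p :: "('a \<times> 'b) \<Rightarrow>\<^sub>0 complex"
  have E_superset: "E p = (\<Sum>k\<in>S. Poly_Mapping.lookup p k *\<^sub>C f (fst k) (snd k))"
    if "finite S" "Poly_Mapping.keys p \<subseteq> S" for p S
    unfolding E_def by (rule sum.mono_neutral_left) (use that in \<open>auto simp: in_keys_iff\<close>)
  have E_lin: "clinear E"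
  proof (rule clinearI)
    fix p q :: "('a \<times> 'b) \<Rightarrow>\<^sub>0 complex" and c :: complex
    let ?S = "Poly_Mapping.keys p \<union> Poly_Mapping.keys q"
    have "E (p + q) = (\<Sum>k\<in>?S. Poly_Mapping.lookup (p + q) k *\<^sub>C f (fst k) (snd k))"
      by (rule E_superset) (auto simp: Poly_Mapping.keys_add)
    also have "\<dots> = E p + E q"
      by (simp add: E_superset[of ?S p] E_superset[of ?S q] lookup_add scaleC_add_left sum.distrib)
    finally show "E (p + q) = E p + E q" .
    have "E (c *\<^sub>C p) = (\<Sum>k\<in>Poly_Mapping.keys p. Poly_Mapping.lookup (c *\<^sub>C p) k *\<^sub>C f (fst k) (snd k))"
      by (rule E_superset) (auto simp: in_keys_iff lookup_scaleC)
    then show "E (c *\<^sub>C p) = c *\<^sub>C E p"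
      by (simp add: lookup_scaleC E_def scaleC_complex_def cvec.scale_sum_right scaleC_scaleC)
  qed
  have E_single: "E (Poly_Mapping.single (v, w) 1) = f v w" for v w
    by (simp add: E_def scaleC_one)
  have lin: "clinear (f v)" "clinear (\<lambda>v. f v w)" for v w
    using f by (auto simp: cbilinear_def)
  have "bilinearity_relations \<subseteq> {p. E p = 0}"
    unfolding bilinearity_relations_def
  proof (rule cvec.span_minimal)
    show "cvec.subspace {p. E p = 0}"
      by (rule cvec.subspaceI) (auto simp: clinear_0[OF E_lin] clinear_add[OF E_lin] clinear_scale[OF E_lin])
  qed (auto simp: clinear_diff[OF E_lin] clinear_scale[OF E_lin] E_single
      clinear_add[OF lin(1)] clinear_add[OF lin(2)] clinear_scale[OF lin(1)] clinear_scale[OF lin(2)])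
  then have rel: "E p = E q" if "tensor_eq p q" for p q
    using that clinear_diff[OF E_lin, of p q] by (auto simp: tensor_eq_def)
  have lift: "tensor_lift f (abs_tensor p) = E p" for p
  proof -
    have "tensor_eq (rep_tensor (abs_tensor p)) p"
      using Quotient3_rep_abs[OF Quotient3_tensor]
      by (simp add: tensor_eq_def cvec.subspace_0[OF subspace_bilinearity_relations])
    then show ?thesis
      by (simp add: tensor_lift_def Let_def E_def[symmetric] rel)
  qed
  show "clinear (tensor_lift f)"
  proof (rule clinearI)
    show "tensor_lift f (s + t) = tensor_lift f s + tensor_lift f t" for s t
      by (induct s, induct t) (simp add: plus_tensor.abs_eq lift clinear_add[OF E_lin])
    show "tensor_lift f (c *\<^sub>C t) = c *\<^sub>C tensor_lift f t" for c t
      by (induct t) (simp add: scaleC_tensor.abs_eq lift clinear_scale[OF E_lin])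
  qed
  show "tensor_lift f (v \<otimes> w) = f v w"
    by (simp add: pure_tensor_def lift E_single)
qed

definition ctrilinear where
  "ctrilinear g \<longleftrightarrow> (\<forall>h. cbilinear (g h)) \<and> (\<forall>a k. clinear (\<lambda>h. g h a k))"

lemma ctrilinearI:
  "(\<And>h a. clinear (g h a)) \<Longrightarrow> (\<And>h k. clinear (\<lambda>a. g h a k)) \<Longrightarrow> (\<And>a k. clinear (\<lambda>h. g h a k))
    \<Longrightarrow> ctrilinear g"
  by (simp add: ctrilinear_def cbilinear_def)

definition tensor_lift3 ::
    "('u::complex_vector \<Rightarrow> 'v::complex_vector \<Rightarrow> 'w::complex_vector \<Rightarrow> 'x::complex_vector)
      \<Rightarrow> ('u, ('v, 'w) tensor) tensor \<Rightarrow> 'x" where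
  "tensor_lift3 g = tensor_lift (\<lambda>h. tensor_lift (g h))"

text \<open>
  For a fixed tensor \<open>t\<close> the inner lift is additive and homogeneous in \<open>h\<close>, because both sides of
  the two identities are linear in \<open>t\<close> and agree on pure tensors. So the outer lift applies.
\<close>

lemma
  assumes g: "ctrilinear g"
  shows clinear_tensor_lift3: "clinear (tensor_lift3 g)"
    and tensor_lift3_pure: "tensor_lift3 g (h \<otimes> a \<otimes> k) = g h a k"
proof -
  have bil: "cbilinear (g h)" for h
    using g by (simp add: ctrilinear_def)
  have lin: "clinear (\<lambda>h. g h a k)" for a k
    using g by (simp add: ctrilinear_def)
  note lift = clinear_tensor_lift[OF bil] tensor_lift_pure[OF bil]
  have "clinear (\<lambda>h. tensor_lift (g h) t)" for t
  proof (rule clinearI)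
    fix h h' c
    show "tensor_lift (g (h + h')) t = tensor_lift (g h) t + tensor_lift (g h') t"
      by (rule clinear_eq_on_pure_tensors[OF lift(1)])
        (auto intro!: clinearI simp: lift(2) clinear_add[OF lin] clinear_add[OF lift(1)]
          clinear_scale[OF lift(1)] scaleC_add_right)
    show "tensor_lift (g (c *\<^sub>C h)) t = c *\<^sub>C tensor_lift (g h) t"
      by (rule clinear_eq_on_pure_tensors[OF lift(1)])
        (auto intro!: clinearI simp: lift(2) clinear_scale[OF lin] clinear_add[OF lift(1)]
          clinear_scale[OF lift(1)] scaleC_add_right scaleC_scaleC mult.commute)
  qed
  then have "cbilinear (\<lambda>h. tensor_lift (g h))"
    by (simp add: cbilinear_def lift(1))
  then show "clinear (tensor_lift3 g)" "tensor_lift3 g (h \<otimes> a \<otimes> k) = g h a k"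
    by (simp_all add: tensor_lift3_def clinear_tensor_lift tensor_lift_pure lift(2))
qed

lemma clinear_eq_on_pure_triples:
  assumes "clinear f" "clinear g" "\<And>h a k. f (h \<otimes> a \<otimes> k) = g (h \<otimes> a \<otimes> k)"
  shows "f t = g t"
proof (rule clinear_eq_on_pure_tensors[OF assms(1,2)])
  fix h t
  have comp: "clinear (\<lambda>t. F (h \<otimes> t))" if "clinear F" for F :: "('a, ('b, 'c) tensor) tensor \<Rightarrow> 'd"
    by (rule clinearI) (simp_all add: pure_tensor_add_right pure_tensor_scale_right
        clinear_add[OF that] clinear_scale[OF that])
  show "f (h \<otimes> t) = g (h \<otimes> t)"
    by (rule clinear_eq_on_pure_tensors[OF comp[OF assms(1)] comp[OF assms(2)] assms(3)])
qed

lemma tensor_subspace3_eq_span: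
  "tensor_subspace U (tensor_subspace V W) =
     cvec.span {h \<otimes> a \<otimes> k | h a k. h \<in> U \<and> a \<in> V \<and> k \<in> W}" (is "_ = cvec.span ?G")
proof
  have "h \<otimes> t \<in> cvec.span ?G" if "h \<in> U" "t \<in> tensor_subspace V W" for h t
    by (rule clinear_image_span_subset[OF clinear_pure_tensor_right,
          where B = "{v \<otimes> w | v w. v \<in> V \<and> w \<in> W}"])
      (use that in \<open>auto simp: tensor_subspace_def intro!: cvec.span_base\<close>)
  then show "tensor_subspace U (tensor_subspace V W) \<subseteq> cvec.span ?G"
    unfolding tensor_subspace_def[of U] by (intro cvec.span_minimal) auto
  have "?G \<subseteq> {v \<otimes> w | v w. v \<in> U \<and> w \<in> tensor_subspace V W}"
    using cvec.span_base[of _ "{v \<otimes> w | v w. v \<in> V \<and> w \<in> W}"]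
    unfolding tensor_subspace_def by blast
  then show "cvec.span ?G \<subseteq> tensor_subspace U (tensor_subspace V W)"
    unfolding tensor_subspace_def[of U] by (rule cvec.span_mono)
qed

text \<open>
  The prescribed values on pure tensors leave at most one linear functional on their span; the
  restriction of the functional on the whole tensor product that a linear extension of \<open>f\<close> defines is
  one.
\<close>

lemma tensor_functional_eq:
  fixes f' :: "'a::complex_vector \<Rightarrow> complex" and g :: "'b::complex_vector \<Rightarrow> complex"
  assumes f: "clinear f'" "\<And>v. v \<in> V \<Longrightarrow> f' v = f v" and g: "clinear g"
    and t: "t \<in> tensor_subspace V UNIV"
  shows "tensor_functional V UNIV f g t = tensor_lift (\<lambda>v w. f' v * g w) t"
proof -
  let ?S = "tensor_subspace V UNIV"
  let ?P = "\<lambda>h. h \<in> extensional ?S \<and> linear_on ?S h \<and> (\<forall>v\<in>V. \<forall>w\<in>UNIV. h (v \<otimes> w) = f v * g w)"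
  have "cbilinear (\<lambda>v w. f' v * g w)"
    using f(1) g by (auto simp: cbilinear_def linear_on_def scaleC_complex_def algebra_simps)
  note lift = clinear_tensor_lift[OF this] tensor_lift_pure[OF this]
  have sub: "cvec.subspace ?S"
    unfolding tensor_subspace_def by (rule cvec.subspace_span)
  have pure: "v \<otimes> w \<in> ?S" if "v \<in> V" for v and w :: 'b
    using that unfolding tensor_subspace_def by (auto intro: cvec.span_base)
  let ?h = "restrict (tensor_lift (\<lambda>v w. f' v * g w)) ?S"
  have P: "?P ?h"
    using linear_on_mono[OF lift(1), of ?S] pure
    by (auto simp: linear_on_def lift(2) f(2) cvec.subspace_add[OF sub] cvec.subspace_scale[OF sub])
  moreover have "h = ?h" if h: "?P h" for h
  proof (rule extensionalityI[of _ ?S])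
    show "h \<in> extensional ?S" "?h \<in> extensional ?S"
      using h P by blast+
    fix t :: "('a, 'b) tensor" assume t: "t \<in> ?S"
    let ?B = "{v \<otimes> w | v w. v \<in> V \<and> w \<in> (UNIV :: 'b set)}"
    have "?B \<subseteq> ?S" using pure by blast
    moreover have "h x = ?h x" if x: "x \<in> ?B" for x
    proof -
      obtain v and w :: 'b where "x = v \<otimes> w" "v \<in> V" using x by blast
      then show ?thesis using h P by simp
    qed
    moreover have "linear_on ?S h" "linear_on ?S ?h" using h P by blast+
    ultimately show "h t = ?h t"
      using linear_on_eq_on_span[OF sub, of ?B h ?h t] t unfolding tensor_subspace_def by blast
  qed
  ultimately have "tensor_functional V UNIV f g = ?h"
    unfolding tensor_functional_def by (rule the_equality)
  then show ?thesis using t by simp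
qed

section \<open>Representations of the free product\<close>

lemma star_zero: "star 0 = (0 :: 'a::complex_star_algebra)"
  using star_add[of "0 :: 'a" 0] by simp

lemma star_one: "star 1 = (1 :: 'b::unital_complex_star_algebra)"
  using star_mult[of "star 1 :: 'b" 1] by (simp add: star_star)

text \<open>
  Operators on a bare vector space have no adjoints, so \<open>Star\<close> cannot be interpreted as an operation on
  them. The flag selects whether a term or its formal adjoint is interpreted: \<open>Star\<close> flips it, products
  are then read backwards and scalars conjugated, and the adjoint is only ever taken of generators.
\<close>

primrec fp_operator ::
    "('a::complex_star_algebra \<Rightarrow> 'v::complex_vector \<Rightarrow> 'v) \<Rightarrow> ('b::unital_complex_star_algebra \<Rightarrow> 'v \<Rightarrow> 'v)
      \<Rightarrow> ('a, 'b) fp_term \<Rightarrow> bool \<Rightarrow> 'v \<Rightarrow> 'v" where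
  "fp_operator K L (Left a) s = K (if s then star a else a)"
| "fp_operator K L (Right b) s = L (if s then star b else b)"
| "fp_operator K L (Add t u) s = (\<lambda>v. fp_operator K L t s v + fp_operator K L u s v)"
| "fp_operator K L (Mul t u) s =
     (if s then fp_operator K L u s \<circ> fp_operator K L t s else fp_operator K L t s \<circ> fp_operator K L u s)"
| "fp_operator K L (Scale c t) s = (\<lambda>v. (if s then cnj c else c) *\<^sub>C fp_operator K L t s v)"
| "fp_operator K L (Star t) s = fp_operator K L t (\<not> s)"

text \<open>
  Two actions on one vector space, by \<open>\<A>\<close> and unitally by \<open>\<B>\<close>, combine to an action of the free product.
  The actions carry no involution, which distinguishes this from the universal property for
  \<open>*\<close>-homomorphisms.
\<close>

lemma free_product_representation:
  fixes K :: "'a::complex_star_algebra \<Rightarrow> 'v::complex_vector \<Rightarrow> 'v"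
    and L :: "'b::unital_complex_star_algebra \<Rightarrow> 'v \<Rightarrow> 'v"
  assumes K: "\<And>a. clinear (K a)" "\<And>v. clinear (\<lambda>a. K a v)" "\<And>a a' v. K (a * a') v = K a (K a' v)"
    and L: "\<And>b. clinear (L b)" "\<And>v. clinear (\<lambda>b. L b v)" "\<And>b b' v. L (b * b') v = L b (L b' v)"
      "\<And>v. L 1 v = v"
  obtains \<rho> :: "('a, 'b) free_product \<Rightarrow> 'v \<Rightarrow> 'v"
  where "\<And>x. clinear (\<rho> x)" "\<And>v. clinear (\<lambda>x. \<rho> x v)" "\<And>x y v. \<rho> (x * y) v = \<rho> x (\<rho> y v)"
    "\<And>a. \<rho> (incl_A a) = K a" "\<And>b. \<rho> (incl_B b) = L b"
proof -
  have lin: "clinear (fp_operator K L t s)" for t s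
    by (induction t arbitrary: s)
      (auto intro!: clinearI simp: K(1) L(1) clinear_add clinear_scale scaleC_add_right
        scaleC_scaleC mult.commute algebra_simps)
  have cong: "fp_operator K L t = fp_operator K L u" if "free_product_eq t u" for t u
  proof (intro ext)
    fix s v
    have "\<forall>s v. fp_operator K L t s v = fp_operator K L u s v"
      using that
      by (induction rule: free_product_eq.induct)
        (simp_all add: clinear_add[OF K(2)] clinear_scale[OF K(2)] clinear_add[OF L(2)]
          clinear_scale[OF L(2)] clinear_0[OF L(2)] K(3) L(3,4) clinear_add[OF lin]
          clinear_scale[OF lin] star_zero star_one star_add star_scaleC star_mult star_star
          scaleC_add_right scaleC_add_left scaleC_scaleC scaleC_one
          algebra_simps)
    then show "fp_operator K L t s v = fp_operator K L u s v" by blast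
  qed
  define \<rho> :: "('a, 'b) free_product \<Rightarrow> 'v \<Rightarrow> 'v"
    where "\<rho> x = fp_operator K L (rep_free_product x) False" for x
  have abs: "\<rho> (abs_free_product t) = fp_operator K L t False" for t
    unfolding \<rho>_def
    by (subst cong[of _ t]) (simp_all add: Quotient3_rep_abs[OF Quotient3_free_product] fp_refl)
  show thesis
  proof (rule that)
    show "clinear (\<rho> x)" for x
      by (simp add: \<rho>_def lin)
    show "clinear (\<lambda>x. \<rho> x v)" for v
    proof (rule clinearI)
      show "\<rho> (x + y) v = \<rho> x v + \<rho> y v" for x y
        by (induct x, induct y) (simp add: plus_free_product.abs_eq abs)
      show "\<rho> (c *\<^sub>C x) v = c *\<^sub>C \<rho> x v" for c x
        by (induct x) (simp add: scaleC_free_product.abs_eq abs)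
    qed
    show "\<rho> (x * y) v = \<rho> x (\<rho> y v)" for x y v
      by (induct x, induct y) (simp add: times_free_product.abs_eq abs)
  qed (simp_all add: incl_A.abs_eq incl_B.abs_eq abs)
qed

section \<open>Collapsing the free product to three legs\<close>

lemma clinear_incl_A: "clinear incl_A"
  by (rule clinearI; transfer) (rule fp_Left_add fp_Left_scale)+

lemma clinear_incl_B: "clinear incl_B"
  by (rule clinearI; transfer) (rule fp_Right_add fp_Right_scale)+

lemma incl_A_mult: "incl_A (a * a') = incl_A a * incl_A a'"
  by transfer (rule fp_Left_mul)

lemma incl_B_mult: "incl_B (b * b') = incl_B b * incl_B b'"
  by transfer (rule fp_Right_mul)

lemma incl_B_one: "incl_B 1 = 1"
  by transfer (rule fp_refl)

instantiation prod :: (complex_vector, complex_vector) complex_vector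
begin
definition scaleC_prod :: "complex \<Rightarrow> 'a \<times> 'b \<Rightarrow> 'a \<times> 'b"
  where "scaleC_prod c x = (c *\<^sub>C fst x, c *\<^sub>C snd x)"
instance
  by standard (auto simp: scaleC_prod_def scaleC_add_right scaleC_add_left scaleC_scaleC scaleC_one
      intro: prod_eqI)
end

lemma fst_scaleC [simp]: "fst (c *\<^sub>C x) = c *\<^sub>C fst x"
  and snd_scaleC [simp]: "snd (c *\<^sub>C x) = c *\<^sub>C snd x"
  by (simp_all add: scaleC_prod_def)

lemmas pure_tensor_linear_simps =
  pure_tensor_add_left pure_tensor_add_right pure_tensor_scale_left pure_tensor_scale_right

text \<open>
  \<open>KM\<close> and \<open>LM\<close> are the actions of \<open>\<A>\<close> and \<open>\<B>\<close> on three-legged tensors, \<open>K\<close> and \<open>L\<close> those on the direct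
  sum with \<open>\<B>\<close>, and \<open>X\<close> reads off the three-legged part of the orbit of the unit of \<open>\<B>\<close>. In a mixed
  product the rightmost \<open>a\<^sub>n b\<^sub>n\<close> creates \<open>1 \<otimes> a\<^sub>n \<otimes> b\<^sub>n\<close>; each further \<open>b\<^sub>i\<close> is stored in the first leg and
  turned into the factor \<open>\<tau>(b\<^sub>i)\<close> by the next \<open>a\<^sub>i\<close>. The last property is the same mechanism: after \<open>a'\<close>
  the first leg is \<open>1\<close>, after \<open>b\<close> it is \<open>b\<close>, and \<open>a\<close> evaluates \<open>\<tau>\<close> there.
\<close>

lemma collapse_map:
  fixes \<tau> :: "'b::unital_complex_star_algebra \<Rightarrow> complex"
  assumes \<tau>: "clinear \<tau>" "\<tau> 1 = 1"
  obtains X :: "('a::complex_star_algebra, 'b) free_product \<Rightarrow> ('b, ('a, 'b) tensor) tensor"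
  where "clinear X"
    "\<And>n a b. n \<ge> 1 \<Longrightarrow> X (mixed_product n a b) =
       (\<Prod>i\<in>{1..<n}. \<tau> (b i)) *\<^sub>C (b 0 \<otimes> nonempty_prod (map a [1..<Suc n]) \<otimes> b n)"
    "\<And>x a b a' y. \<tau> b = 0 \<Longrightarrow> X (x * (incl_A a * incl_B b * incl_A a') * y) = 0"
proof -
  define KM :: "'a \<Rightarrow> ('b, ('a, 'b) tensor) tensor \<Rightarrow> ('b, ('a, 'b) tensor) tensor"
    where "KM a = tensor_lift3 (\<lambda>h a' k. \<tau> h *\<^sub>C (1 \<otimes> (a * a') \<otimes> k))" for a
  define LM :: "'b \<Rightarrow> ('b, ('a, 'b) tensor) tensor \<Rightarrow> ('b, ('a, 'b) tensor) tensor"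
    where "LM b = tensor_lift3 (\<lambda>h a k. (b * h) \<otimes> a \<otimes> k)" for b
  have "ctrilinear (\<lambda>h a' k. \<tau> h *\<^sub>C ((1::'b) \<otimes> (a * a') \<otimes> (k::'b)))" for a :: 'a
    by (intro ctrilinearI clinearI)
      (simp_all add: pure_tensor_linear_simps distrib_left mult_scaleC_right clinear_add[OF \<tau>(1)]
        clinear_scale[OF \<tau>(1)] scaleC_add_right scaleC_add_left scaleC_scaleC scaleC_complex_def mult.commute)
  note KM = clinear_tensor_lift3[OF this, folded KM_def] tensor_lift3_pure[OF this, folded KM_def]
  have "ctrilinear (\<lambda>h a' k. (b * h) \<otimes> (a'::'a) \<otimes> (k::'b))" for b :: 'b
    by (intro ctrilinearI clinearI)
      (simp_all add: pure_tensor_linear_simps distrib_left mult_scaleC_right)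
  note LM = clinear_tensor_lift3[OF this, folded LM_def] tensor_lift3_pure[OF this, folded LM_def]
  note lin = clinear_add[OF KM(1)] clinear_scale[OF KM(1)] clinear_add[OF LM(1)] clinear_scale[OF LM(1)]
  have KM_add: "KM (a + a') m = KM a m + KM a' m" for a a' m
    by (rule clinear_eq_on_pure_triples[OF KM(1)])
      (auto intro!: clinearI simp: lin KM(2) scaleC_add_right distrib_right pure_tensor_linear_simps)
  have KM_scale: "KM (c *\<^sub>C a) m = c *\<^sub>C KM a m" for c a m
    by (rule clinear_eq_on_pure_triples[OF KM(1)])
      (auto intro!: clinearI simp: lin KM(2) scaleC_add_right mult_scaleC_left pure_tensor_linear_simps
        scaleC_scaleC mult.commute)
  have KM_mult: "KM (a * a') m = KM a (KM a' m)" for a a' m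
    by (rule clinear_eq_on_pure_triples[OF KM(1)])
      (auto intro!: clinearI simp: lin KM(2) \<tau>(2) scaleC_one mult.assoc)
  have LM_add: "LM (b + b') m = LM b m + LM b' m" for b b' m
    by (rule clinear_eq_on_pure_triples[OF LM(1)])
      (auto intro!: clinearI simp: lin LM(2) scaleC_add_right distrib_right pure_tensor_linear_simps)
  have LM_scale: "LM (c *\<^sub>C b) m = c *\<^sub>C LM b m" for c b m
    by (rule clinear_eq_on_pure_triples[OF LM(1)])
      (auto intro!: clinearI simp: lin LM(2) scaleC_add_right mult_scaleC_left pure_tensor_linear_simps
        scaleC_scaleC mult.commute)
  have LM_mult: "LM (b * b') m = LM b (LM b' m)" for b b' m
    by (rule clinear_eq_on_pure_triples[OF LM(1)])
      (auto intro!: clinearI simp: lin LM(2) mult.assoc)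
  have LM_one: "LM 1 m = m" for m
    by (rule clinear_eq_on_pure_triples[OF LM(1)]) (auto intro!: clinearI simp: LM(2))
  define K :: "'a \<Rightarrow> ('b, ('a, 'b) tensor) tensor \<times> 'b \<Rightarrow> ('b, ('a, 'b) tensor) tensor \<times> 'b"
    where "K a v = (KM a (fst v) + 1 \<otimes> a \<otimes> snd v, 0)" for a v
  define L :: "'b \<Rightarrow> ('b, ('a, 'b) tensor) tensor \<times> 'b \<Rightarrow> ('b, ('a, 'b) tensor) tensor \<times> 'b"
    where "L b v = (LM b (fst v), b * snd v)" for b v
  obtain \<rho> :: "('a, 'b) free_product \<Rightarrow> ('b, ('a, 'b) tensor) tensor \<times> 'b \<Rightarrow> ('b, ('a, 'b) tensor) tensor \<times> 'b"
    where \<rho>: "\<And>x. clinear (\<rho> x)" "\<And>v. clinear (\<lambda>x. \<rho> x v)" "\<And>x y v. \<rho> (x * y) v = \<rho> x (\<rho> y v)"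
      "\<And>a. \<rho> (incl_A a) = K a" "\<And>b. \<rho> (incl_B b) = L b"
  proof (rule free_product_representation[of K L])
    show "clinear (K a)" "clinear (\<lambda>a. K a v)" "K (a * a') v = K a (K a' v)" for a a' v
      by (auto intro!: clinearI prod_eqI simp: K_def lin KM_add KM_scale KM_mult KM(2) \<tau>(2)
          pure_tensor_linear_simps scaleC_add_right scaleC_one)
    show "clinear (L b)" "clinear (\<lambda>b. L b v)" "L (b * b') v = L b (L b' v)" "L 1 v = v" for b b' v
      by (auto intro!: clinearI prod_eqI simp: L_def lin LM_add LM_scale LM_mult LM_one
          distrib_left distrib_right mult_scaleC_left mult_scaleC_right mult.assoc)
  qed blast
  have \<rho>_one: "\<rho> 1 v = v" for v
    using \<rho>(5)[of 1] by (simp add: incl_B_one L_def LM_one)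
  define X where "X x = fst (\<rho> x (0, 1))" for x
  \<comment> \<open>The factors \<open>a\<^sub>i b\<^sub>i\<close> act from the right end inwards, hence the downward induction on the first index \<open>m\<close>.\<close>
  have mid: "\<rho> (\<Prod>i\<leftarrow>[m..<Suc n]. incl_A (a i) * incl_B (b i)) (0, 1) =
      ((\<Prod>i\<in>{m..<n}. \<tau> (b i)) *\<^sub>C (1 \<otimes> nonempty_prod (map a [m..<Suc n]) \<otimes> b n), 0)"
    if "m \<le> n" for m n a b
    using that
  proof (induction m rule: inc_induct)
    case base
    then show ?case
      by (simp add: \<rho> \<rho>_one K_def L_def clinear_0[OF KM(1)] clinear_0[OF LM(1)] scaleC_one)
  next
    case (step m)
    have "nonempty_prod (map a [m..<Suc n]) = a m * nonempty_prod (map a [Suc m..<Suc n])"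
      using step.hyps by (cases "[Suc m..<Suc n]") (simp_all add: upt_conv_Cons del: upt_Suc)
    then show ?case
      using step.hyps step.IH
      by (simp add: upt_conv_Cons[of m] \<rho> K_def L_def lin LM(2) KM(2) scaleC_scaleC
          prod.atLeast_Suc_lessThan mult.commute pure_tensor_linear_simps del: upt_Suc)
  qed
  show thesis
  proof (rule that)
    show "clinear X"
      by (rule clinearI) (simp_all add: X_def clinear_add[OF \<rho>(2)] clinear_scale[OF \<rho>(2)])
    show "X (mixed_product n a b) =
       (\<Prod>i\<in>{1..<n}. \<tau> (b i)) *\<^sub>C (b 0 \<otimes> nonempty_prod (map a [1..<Suc n]) \<otimes> b n)"
      if "n \<ge> 1" for n a b
      using mid[OF that, of a b] by (simp add: X_def mixed_product_def \<rho> L_def lin LM(2) del: upt_Suc)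
    show "X (x * (incl_A a * incl_B b * incl_A a') * y) = 0" if "\<tau> b = 0" for x a b a' y
    proof -
      have K_range: "fst (K a' v) \<in> {m. KM a (LM b m) = 0}" for v
      proof -
        have "KM a (LM b (KM a' m)) = 0" for m
          by (rule clinear_eq_on_pure_triples) (auto intro!: clinearI simp: lin KM(2) LM(2) that)
        then show ?thesis
          by (simp add: K_def lin KM(2) LM(2) that)
      qed
      have "K a (L b (K a' v)) = 0" for v
        using K_range by (simp add: K_def[of a] L_def K_def[of a'] zero_prod_def)
      then show ?thesis
        by (simp add: X_def \<rho> clinear_0[OF \<rho>(1)])
    qed
  qed
qed

section \<open>The ideals of alternating words\<close>

lemma alternating_iff_successively: "alternating w \<longleftrightarrow> successively (\<lambda>x y. isl x \<noteq> isl y) w"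
  by (auto simp: alternating_def successively_conv_nth)

lemma alternating_simps [simp]:
  "alternating []" "alternating [x]"
  "alternating (x # y # w) \<longleftrightarrow> isl x \<noteq> isl y \<and> alternating (y # w)"
  by (auto simp: alternating_iff_successively)

lemma alternating_rev_map_sum:
  fixes w :: "('a + 'b) list"
  shows "alternating (rev (map (map_sum f g) w)) \<longleftrightarrow> alternating w"
proof -
  have "successively (\<lambda>x y. isl y \<noteq> isl x) w = successively (\<lambda>x y. isl x \<noteq> isl y) w"
    by (rule arg_cong[where f = "\<lambda>R. successively R w"]) auto
  then show ?thesis
    by (simp add: alternating_iff_successively successively_map successively_rev isl_map_sum)
qed

lemma alternating_no_left_leg:
  assumes "alternating w" "filter isl w = []"
  obtains "w = []" | b where "w = [Inr b]"
proof (cases w)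
  case (Cons x v)
  with assms have "v = []" "\<not> isl x"
    by (cases v; auto split: if_splits)+
  with Cons that(2) show thesis by (cases x) auto
qed (use that in simp)

lemma alternating_one_left_leg:
  assumes "alternating w" "length (filter isl w) = 1"
  obtains a where "w = [Inl a]" | a b where "w = [Inl a, Inr b]" | b a where "w = [Inr b, Inl a]"
    | b a b' where "w = [Inr b, Inl a, Inr b']"
proof -
  obtain x where x: "filter isl w = [x]"
    using assms(2) by (auto simp: length_Suc_conv)
  then obtain u v where w: "w = u @ x # v" and "isl x" and uv: "filter isl u = []" "filter isl v = []"
    by (metis (no_types, lifting) filter_eq_Cons_iff filter_empty_conv)
  then obtain a where "x = Inl a" by (cases x) auto
  moreover have "alternating u" "alternating v"
    using assms(1) unfolding w alternating_iff_successively
    by (auto simp: successively_append_iff successively_Cons split: if_splits)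
  ultimately show thesis
    using that w by (elim alternating_no_left_leg[OF _ uv(1)] alternating_no_left_leg[OF _ uv(2)]) auto
qed

text \<open>
  Two neighbouring legs in \<open>\<A>\<close> of an alternating word are separated by a single leg in \<open>\<B>\<close>.
\<close>

lemma alternating_two_left_legs:
  assumes "alternating w" "2 \<le> length (filter isl w)"
  obtains u a b a' v where "w = u @ [Inl a, Inr b, Inl a'] @ v"
proof -
  have "\<exists>u a b a' v. w = u @ [Inl a, Inr b, Inl a'] @ v"
    using assms
  proof (induction w)
    case (Cons x w)
    have w: "alternating w"
      using Cons.prems(1) by (cases w) auto
    show ?case
    proof (cases "2 \<le> length (filter isl w)")
      case True
      then obtain u a b a' v where "w = u @ [Inl a, Inr b, Inl a'] @ v"
        using Cons.IH w by blast
      then have "x # w = (x # u) @ [Inl a, Inr b, Inl a'] @ v" by simp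
      then show ?thesis by blast
    next
      case False
      with Cons.prems have "isl x" "length (filter isl w) = 1"
        by (auto split: if_splits)
      moreover from \<open>isl x\<close> Cons.prems(1) have "w = [] \<or> \<not> isl (hd w)"
        by (cases w) auto
      ultimately obtain a b a' v where "x # w = [Inl a, Inr b, Inl a'] @ v"
        using w by (elim alternating_one_left_leg[of w]) (auto simp: isl_def)
      then have "x # w = [] @ [Inl a, Inr b, Inl a'] @ v" by simp
      then show ?thesis by blast
    qed
  qed simp
  then show thesis using that by blast
qed

abbreviation word_prod ::
    "('a + 'b) list \<Rightarrow> ('a::complex_star_algebra, 'b::unital_complex_star_algebra) free_product" where
  "word_prod w \<equiv> prod_list (map incl_leg w)"

text \<open>
  This family interpolates between \<open>I\<close> (\<open>m = 1\<close>) and \<open>J\<close> (\<open>m = 2\<close>), so that both are handled by the same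
  closure arguments.
\<close>

definition word_span :: "'a::complex_star_algebra set \<Rightarrow> ('b::unital_complex_star_algebra \<Rightarrow> complex)
    \<Rightarrow> nat \<Rightarrow> ('a, 'b) free_product set" where
  "word_span D \<tau> m = cvec.span {word_prod w | w.
     alternating w \<and> legs_in D (ring_B \<tau>) w \<and> m \<le> length (filter isl w)}"

lemma subspace_word_span: "cvec.subspace (word_span D \<tau> m)"
  unfolding word_span_def by (rule cvec.subspace_span)

lemma J_space_eq_word_span: "J_space D \<tau> = word_span D \<tau> 2"
  by (simp add: J_space_def word_span_def)

lemma word_span_antimono: "m \<le> n \<Longrightarrow> word_span D \<tau> n \<subseteq> word_span D \<tau> m"
  unfolding word_span_def by (rule cvec.span_mono) auto

lemma word_prod_in_word_span:
  "alternating w \<Longrightarrow> legs_in D (ring_B \<tau>) w \<Longrightarrow> m \<le> length (filter isl w) \<Longrightarrow> word_prod w \<in> word_span D \<tau> m"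
  unfolding word_span_def by (rule cvec.span_base) auto

lemma word_span_image_subset:
  assumes "clinear f"
    and "\<And>w. alternating w \<Longrightarrow> legs_in D (ring_B \<tau>) w \<Longrightarrow> m \<le> length (filter isl w) \<Longrightarrow>
      f (word_prod w) \<in> word_span D \<tau> m"
    and "y \<in> word_span D \<tau> m"
  shows "f y \<in> word_span D \<tau> m"
  using assms(2) unfolding word_span_def
  by (intro clinear_image_span_subset[OF assms(1) _ assms(3)[unfolded word_span_def]]) blast

lemma legs_in_simps [simp]:
  "legs_in D C []" "legs_in D C (Inl a # w) \<longleftrightarrow> a \<in> D \<and> legs_in D C w"
  "legs_in D C (Inr b # w) \<longleftrightarrow> b \<in> C \<and> legs_in D C w"
  "legs_in D C (u @ v) \<longleftrightarrow> legs_in D C u \<and> legs_in D C v"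
  by (auto simp: legs_in_def)

lemma legs_in_rev_map_sum:
  "legs_in D C w \<Longrightarrow> (\<And>a. a \<in> D \<Longrightarrow> f a \<in> D) \<Longrightarrow> (\<And>b. b \<in> C \<Longrightarrow> g b \<in> C) \<Longrightarrow>
    legs_in D C (rev (map (map_sum f g) w))"
proof (induction w)
  case (Cons x w)
  then show ?case by (cases x) auto
qed simp

text \<open>
  An alternating word with exactly one leg in \<open>D\<close> has at most one leg on each side of it, which gives
  the four forms in the definition of \<open>I\<close>.
\<close>

lemma I_space_eq_word_span: "I_space D \<tau> = word_span D \<tau> 1"
proof
  show "I_space D \<tau> \<subseteq> word_span D \<tau> 1"
    unfolding I_space_def
  proof (rule cvec.span_minimal[OF _ subspace_word_span], intro Un_least)
    show "J_space D \<tau> \<subseteq> word_span D \<tau> 1"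
      unfolding J_space_eq_word_span by (rule word_span_antimono) simp
    show "{incl_A a | a. a \<in> D} \<subseteq> word_span D \<tau> 1"
      using word_prod_in_word_span[of "[Inl _]" D \<tau> 1] by auto
    show "{incl_A a * incl_B b | a b. a \<in> D \<and> b \<in> ring_B \<tau>} \<subseteq> word_span D \<tau> 1"
      using word_prod_in_word_span[of "[Inl _, Inr _]" D \<tau> 1] by auto
    show "{incl_B b * incl_A a | b a. b \<in> ring_B \<tau> \<and> a \<in> D} \<subseteq> word_span D \<tau> 1"
      using word_prod_in_word_span[of "[Inr _, Inl _]" D \<tau> 1] by auto
    show "{incl_B b * incl_A a * incl_B b' | b a b'. b \<in> ring_B \<tau> \<and> a \<in> D \<and> b' \<in> ring_B \<tau>}
        \<subseteq> word_span D \<tau> 1"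
      using word_prod_in_word_span[of "[Inr _, Inl _, Inr _]" D \<tau> 1] by (auto simp: mult.assoc)
  qed
  show "word_span D \<tau> 1 \<subseteq> I_space D \<tau>"
    unfolding word_span_def I_space_def
  proof (rule cvec.span_mono, rule subsetI)
    fix y :: "('a, 'b) free_product"
    assume "y \<in> {word_prod w | w. alternating w \<and> legs_in D (ring_B \<tau>) w \<and> 1 \<le> length (filter isl w)}"
    then obtain w where w: "y = word_prod w" "alternating w" "legs_in D (ring_B \<tau>) w"
      "1 \<le> length (filter isl w)" by blast
    let ?G = "{incl_A a | a. a \<in> D} \<union> {incl_A a * incl_B b | a b. a \<in> D \<and> b \<in> ring_B \<tau>} \<union>
      {incl_B b * incl_A a | b a. b \<in> ring_B \<tau> \<and> a \<in> D} \<union>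
      {incl_B b * incl_A a * incl_B b' | b a b'. b \<in> ring_B \<tau> \<and> a \<in> D \<and> b' \<in> ring_B \<tau>} \<union>
      J_space D \<tau>"
    show "y \<in> ?G"
    proof (cases "2 \<le> length (filter isl w)")
      case True
      then have "y \<in> J_space D \<tau>"
        using w by (simp add: J_space_eq_word_span word_prod_in_word_span)
      then show ?thesis by blast
    next
      case False
      with w(4) have "length (filter isl w) = 1" by simp
      with w(2) show ?thesis
        by (rule alternating_one_left_leg) (use w(1,3) in \<open>auto simp: mult.assoc\<close>)
    qed
  qed
qed

lemma star_incl_A: "star (incl_A a) = incl_A (star a)"
  by transfer (rule fp_sym[OF fp_Left_star])

lemma star_incl_B: "star (incl_B b) = incl_B (star b)"
  by transfer (rule fp_sym[OF fp_Right_star])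

lemma star_word_prod: "star (word_prod w) = word_prod (rev (map (map_sum star star) w))"
proof (induction w)
  case (Cons x w)
  then show ?case by (cases x) (simp_all add: star_mult star_incl_A star_incl_B)
qed (simp add: star_one)

lemma mixed_product_Suc:
  "mixed_product (Suc n) a b = mixed_product n a b * incl_A (a (Suc n)) * incl_B (b (Suc n))"
  by (simp add: mixed_product_def mult.assoc)

lemma mixed_product_cong:
  "(\<And>i. i \<in> {1..n} \<Longrightarrow> a i = a' i) \<Longrightarrow> (\<And>i. i \<in> {0..n} \<Longrightarrow> b i = b' i) \<Longrightarrow>
    mixed_product n a b = mixed_product n a' b'"
  by (induction n) (simp_all add: mixed_product_Suc, simp add: mixed_product_def)

lemma mixed_product_mult_incl_B:
  "mixed_product n a b * incl_B c = mixed_product n a (b(n := b n * c))"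
proof (cases n)
  case (Suc k)
  have "mixed_product k a b = mixed_product k a (b(n := b n * c))"
    by (rule mixed_product_cong) (auto simp: Suc)
  then show ?thesis
    by (simp add: Suc mixed_product_Suc incl_B_mult mult.assoc)
qed (simp add: mixed_product_def incl_B_mult)

lemma mixed_product_mult_incl_A:
  "mixed_product n a b * incl_A c = mixed_product (Suc n) (a(Suc n := c)) (b(Suc n := 1))"
proof -
  have "mixed_product n a b = mixed_product n (a(Suc n := c)) (b(Suc n := 1))"
    by (rule mixed_product_cong) auto
  then show ?thesis
    by (simp add: mixed_product_Suc incl_B_one)
qed

text \<open>
  A word becomes a mixed product with as many factors from \<open>\<A>\<close> by inserting the unit of \<open>\<B>\<close> where a leg
  in \<open>\<B>\<close> is missing; adjacent legs in \<open>\<B>\<close> are multiplied.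
\<close>

lemma word_prod_eq_mixed_product:
  fixes w :: "('a::complex_star_algebra + 'b::unital_complex_star_algebra) list"
  assumes "legs_in D C w"
  obtains a b where "word_prod w = mixed_product (length (filter isl w)) a b"
    "\<forall>i\<in>{1..length (filter isl w)}. a i \<in> D"
proof -
  have "\<exists>a b. word_prod w = mixed_product (length (filter isl w)) a b
      \<and> (\<forall>i\<in>{1..length (filter isl w)}. a i \<in> D)"
    using assms
  proof (induction w rule: rev_induct)
    case Nil
    show ?case
      by (rule exI[of _ "\<lambda>_. 0"], rule exI[of _ "\<lambda>_. 1"]) (simp add: mixed_product_def incl_B_one)
  next
    case (snoc x w)
    then obtain a b where ab: "word_prod w = mixed_product (length (filter isl w)) a b"
      "\<forall>i\<in>{1..length (filter isl w)}. a i \<in> D" by auto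
    let ?n = "length (filter isl w)"
    show ?case
    proof (cases x)
      case (Inl c)
      have "word_prod (w @ [x]) = mixed_product (Suc ?n) (a(Suc ?n := c)) (b(Suc ?n := 1))"
        using ab(1) by (simp add: Inl mixed_product_mult_incl_A del: fun_upd_apply)
      moreover have "\<forall>i\<in>{1..Suc ?n}. (a(Suc ?n := c)) i \<in> D"
        using ab(2) snoc.prems Inl by auto
      moreover have "length (filter isl (w @ [x])) = Suc ?n"
        by (simp add: Inl)
      ultimately show ?thesis by metis
    next
      case (Inr c)
      have "word_prod (w @ [x]) = mixed_product ?n a (b(?n := b ?n * c))"
        using ab(1) by (simp add: Inr mixed_product_mult_incl_B del: fun_upd_apply)
      moreover have "length (filter isl (w @ [x])) = ?n"
        by (simp add: Inr)
      ultimately show ?thesis using ab(2) by metis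
    qed
  qed
  then show thesis using that by blast
qed

locale measure_and_probability_space =
  fixes D :: "'a::complex_star_algebra set"
    and \<omega>0 :: "'a \<Rightarrow> complex"
    and \<tau> :: "'b::unital_complex_star_algebra \<Rightarrow> complex"
  assumes measure_space: "nc_measure_space D \<omega>0"
    and probability_space: "nc_probability_space \<tau>"
begin

abbreviation \<I> :: "('a, 'b) free_product set" where "\<I> \<equiv> I_space D \<tau>"
abbreviation \<J> :: "('a, 'b) free_product set" where "\<J> \<equiv> J_space D \<tau>"

lemma D_subspace: "cvec.subspace D"
  and D_mult: "a \<in> D \<Longrightarrow> a' \<in> D \<Longrightarrow> a * a' \<in> D"
  and D_star: "a \<in> D \<Longrightarrow> star a \<in> D"
  and \<omega>0_linear: "linear_on D \<omega>0"
  using measure_space by (auto simp: nc_measure_space_def star_subalgebra_def)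

lemma \<tau>_linear: "clinear \<tau>"
  and \<tau>_one: "\<tau> 1 = 1"
  and \<tau>_star: "\<tau> (star b) = cnj (\<tau> b)"
  and \<tau>_trace: "\<tau> (b * b') = \<tau> (b' * b)"
  using probability_space by (auto simp: nc_probability_space_def nc_measure_space_def)

text \<open>
  Write \<open>b = \<tau>(b) 1 + (b - \<tau>(b) 1)\<close>. In front of a leg in \<open>D\<close> the first part rescales the word and the
  second part prolongs it; a leading leg in \<open>\<B>\<close> is first absorbed into \<open>b\<close>. The number of legs in \<open>D\<close> is
  the same throughout, and \<open>m \<ge> 1\<close> guarantees that such a leg follows.
\<close>

lemma word_span_mult_incl_B_left:
  assumes "m \<ge> 1" "y \<in> word_span D \<tau> m"
  shows "incl_B b * y \<in> word_span D \<tau> m"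
proof -
  have from_A: "incl_B b * word_prod (Inl a # v) \<in> word_span D \<tau> m"
    if "alternating (Inl a # v)" "legs_in D (ring_B \<tau>) (Inl a # v)"
      "m \<le> length (filter isl (Inl a # v))" for b a v
  proof -
    let ?w = "Inl a # v :: ('a + 'b) list" and ?b = "b - \<tau> b *\<^sub>C 1"
    have "?b \<in> ring_B \<tau>"
      by (simp add: ring_B_def clinear_diff[OF \<tau>_linear] clinear_scale[OF \<tau>_linear] \<tau>_one
          scaleC_complex_def)
    then have "word_prod (Inr ?b # ?w) \<in> word_span D \<tau> m"
      using that by (intro word_prod_in_word_span) auto
    moreover have "word_prod ?w \<in> word_span D \<tau> m"
      using that by (intro word_prod_in_word_span) auto
    moreover have "incl_B b * word_prod ?w = word_prod (Inr ?b # ?w) + \<tau> b *\<^sub>C word_prod ?w"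
      by (simp add: clinear_diff[OF clinear_incl_B] clinear_scale[OF clinear_incl_B] incl_B_one
          left_diff_distrib mult_scaleC_left)
    ultimately show ?thesis
      by (simp add: cvec.subspace_add cvec.subspace_scale subspace_word_span)
  qed
  show ?thesis
  proof (rule word_span_image_subset[OF _ _ assms(2)])
    show "clinear (\<lambda>y. incl_B b * y)"
      by (rule clinearI) (simp_all add: distrib_left mult_scaleC_right)
    fix w :: "('a + 'b) list"
    assume w: "alternating w" "legs_in D (ring_B \<tau>) w" "m \<le> length (filter isl w)"
    show "incl_B b * word_prod w \<in> word_span D \<tau> m"
    proof (cases w)
      case Nil
      then show ?thesis using w assms(1) by simp
    next
      case (Cons x v)
      show ?thesis
      proof (cases x)
        case (Inl a)
        then show ?thesis using from_A w Cons by simp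
      next
        case (Inr b')
        then obtain a v' where "v = Inl a # v'"
          using w assms(1) Cons by (cases v) (auto simp: isl_def)
        then show ?thesis
          using from_A[of a v' "b * b'"] w Cons Inr by (simp add: incl_B_mult mult.assoc)
      qed
    qed
  qed
qed

lemma word_span_mult_incl_A_left:
  assumes "m \<ge> 1" "y \<in> word_span D \<tau> m" "d \<in> D"
  shows "incl_A d * y \<in> word_span D \<tau> m"
proof -
  show ?thesis
  proof (rule word_span_image_subset[OF _ _ assms(2)])
    show "clinear (\<lambda>y. incl_A d * y)"
      by (rule clinearI) (simp_all add: distrib_left mult_scaleC_right)
    fix w :: "('a + 'b) list"
    assume w: "alternating w" "legs_in D (ring_B \<tau>) w" "m \<le> length (filter isl w)"
    show "incl_A d * word_prod w \<in> word_span D \<tau> m"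
    proof (cases w)
      case Nil
      then show ?thesis using w assms(1) by simp
    next
      case (Cons x v)
      show ?thesis
      proof (cases x)
        case (Inl a)
        have "alternating (Inl (d * a) # v)"
          using w Cons Inl by (cases v) auto
        then have "word_prod (Inl (d * a) # v) \<in> word_span D \<tau> m"
          using w Cons Inl assms(3) by (intro word_prod_in_word_span) (auto simp: D_mult)
        then show ?thesis using Cons Inl by (simp add: incl_A_mult mult.assoc)
      next
        case (Inr b)
        then have "word_prod (Inl d # w) \<in> word_span D \<tau> m"
          using w Cons assms(3) by (intro word_prod_in_word_span) auto
        then show ?thesis by simp
      qed
    qed
  qed
qed

text \<open>
  The adjoint reverses words and keeps the types of their legs, so statements about left
  multiplication carry over to right multiplication.
\<close>

lemma word_span_star:
  assumes "y \<in> word_span D \<tau> m"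
  shows "star y \<in> word_span D \<tau> m"
proof -
  have "cvec.subspace {y. star y \<in> word_span D \<tau> m}"
    by (rule cvec.subspaceI)
      (auto simp: star_zero star_add star_scaleC cvec.subspace_0 cvec.subspace_add
        cvec.subspace_scale subspace_word_span)
  then have "word_span D \<tau> m \<subseteq> {y. star y \<in> word_span D \<tau> m}"
    unfolding word_span_def[of D \<tau> m]
  proof (rule cvec.span_minimal[rotated], fold word_span_def, clarify)
    fix w :: "('a + 'b) list"
    assume w: "alternating w" "legs_in D (ring_B \<tau>) w" "m \<le> length (filter isl w)"
    have "legs_in D (ring_B \<tau>) (rev (map (map_sum star star) w))"
      by (rule legs_in_rev_map_sum[OF w(2)]) (simp_all add: ring_B_def D_star \<tau>_star)
    moreover have "length (filter isl (rev (map (map_sum star star) w))) = length (filter isl w)"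
      by (simp add: rev_filter[symmetric] filter_map o_def isl_map_sum)
    ultimately show "star (word_prod w) \<in> word_span D \<tau> m"
      using w unfolding star_word_prod
      by (intro word_prod_in_word_span) (simp_all add: alternating_rev_map_sum)
  qed
  with assms show ?thesis by blast
qed


lemma word_span_mult_incl_right:
  assumes "m \<ge> 1" "y \<in> word_span D \<tau> m"
  shows "y * incl_B b \<in> word_span D \<tau> m"
    and "d \<in> D \<Longrightarrow> y * incl_A d \<in> word_span D \<tau> m"
proof -
  have y: "star y \<in> word_span D \<tau> m"
    using assms(2) by (rule word_span_star)
  have "star (incl_B (star b) * star y) \<in> word_span D \<tau> m"
    by (intro word_span_star word_span_mult_incl_B_left assms(1) y)
  then show "y * incl_B b \<in> word_span D \<tau> m"
    by (simp only: star_mult star_incl_B star_star)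
  assume "d \<in> D"
  then have "star (incl_A (star d) * star y) \<in> word_span D \<tau> m"
    by (intro word_span_star word_span_mult_incl_A_left assms(1) y D_star)
  then show "y * incl_A d \<in> word_span D \<tau> m"
    by (simp only: star_mult star_incl_A star_star)
qed

text \<open>
  The elements of \<open>I\<close> are combinations of products of legs, and \<open>J\<close> is stable under multiplication by each
  single leg.
\<close>

lemma J_ideal_of_I: "is_ideal_of \<J> \<I>"
proof -
  have word: "word_prod w * x \<in> \<J>" if "legs_in D (ring_B \<tau>) w" "x \<in> \<J>" for w x
    using that(1)
  proof (induction w)
    case (Cons l w)
    show ?case
    proof (cases l)
      case (Inl a)
      with Cons have "incl_A a * (word_prod w * x) \<in> \<J>"
        unfolding J_space_eq_word_span by (intro word_span_mult_incl_A_left) simp_all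
      with Inl show ?thesis by (simp add: mult.assoc)
    next
      case (Inr b)
      with Cons have "incl_B b * (word_prod w * x) \<in> \<J>"
        unfolding J_space_eq_word_span by (intro word_span_mult_incl_B_left) simp_all
      with Inr show ?thesis by (simp add: mult.assoc)
    qed
  qed (use that(2) in simp)
  have left: "y * x \<in> \<J>" if "x \<in> \<J>" "y \<in> \<I>" for x y
  proof -
    have "cvec.subspace {y. y * x \<in> \<J>}"
      by (rule cvec.subspaceI)
        (auto simp: J_space_eq_word_span distrib_right mult_scaleC_left
          cvec.subspace_0 cvec.subspace_add cvec.subspace_scale subspace_word_span)
    then have "\<I> \<subseteq> {y. y * x \<in> \<J>}"
      unfolding I_space_eq_word_span word_span_def[of D \<tau> 1]
      by (rule cvec.span_minimal[rotated]) (use word[OF _ that(1)] in auto)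
    with that show ?thesis by blast
  qed
  moreover have "x * y \<in> \<J>" if "x \<in> \<J>" "y \<in> \<I>" for x y
  proof -
    have "star x \<in> \<J>" "star y \<in> \<I>"
      using that word_span_star unfolding J_space_eq_word_span I_space_eq_word_span by blast+
    then have "star (star y * star x) \<in> \<J>"
      using left word_span_star unfolding J_space_eq_word_span by blast
    then show ?thesis by (simp add: star_mult star_star)
  qed
  moreover have "\<J> \<subseteq> \<I>"
    unfolding I_space_eq_word_span J_space_eq_word_span by (rule word_span_antimono) simp
  ultimately show ?thesis
    by (simp add: is_ideal_of_def J_space_eq_word_span subspace_word_span)
qed

lemma incl_A_in_I: "a \<in> D \<Longrightarrow> incl_A a \<in> \<I>"
  unfolding I_space_eq_word_span using word_prod_in_word_span[of "[Inl a]" D \<tau> 1] by simp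

lemma sandwich_in_I: "a \<in> D \<Longrightarrow> incl_B h * incl_A a * incl_B k \<in> \<I>"
  unfolding I_space_eq_word_span
  by (rule word_span_mult_incl_right(1)[OF order_refl word_span_mult_incl_B_left[OF order_refl
        incl_A_in_I[unfolded I_space_eq_word_span]]])

lemma mixed_product_in_I:
  assumes "n \<ge> 1" "\<forall>i\<in>{1..n}. a i \<in> D"
  shows "mixed_product n a b \<in> \<I>"
  using assms
proof (induction n rule: dec_induct)
  case base
  then show ?case
    using sandwich_in_I[of "a 1" "b 0" "b 1"] by (simp add: mixed_product_def mult.assoc)
next
  case (step n)
  then have "mixed_product n a b \<in> word_span D \<tau> 1" "a (Suc n) \<in> D"
    by (simp_all add: I_space_eq_word_span)
  then show ?case
    unfolding mixed_product_Suc I_space_eq_word_span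
    by (intro word_span_mult_incl_right[OF order_refl])
qed

text \<open>
  The mixed products span \<open>I\<close>, which makes the functionals defined through them unique.
\<close>

lemma linear_on_I_eq:
  assumes "linear_on \<I> f" "linear_on \<I> g"
    and "\<And>n a b. n \<ge> 1 \<Longrightarrow> \<forall>i\<in>{1..n}. a i \<in> D \<Longrightarrow> f (mixed_product n a b) = g (mixed_product n a b)"
    and "x \<in> \<I>"
  shows "f x = g x"
proof (rule linear_on_eq_on_span[OF _ _ assms(1,2)])
  let ?W = "{word_prod w | w. alternating w \<and> legs_in D (ring_B \<tau>) w \<and> 1 \<le> length (filter isl w)}"
  show "cvec.subspace \<I>"
    unfolding I_space_eq_word_span by (rule subspace_word_span)
  show "?W \<subseteq> \<I>"
    unfolding I_space_eq_word_span by (auto intro!: word_prod_in_word_span)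
  show "x \<in> cvec.span ?W"
    using assms(4) unfolding I_space_eq_word_span word_span_def .
  show "f y = g y" if y: "y \<in> ?W" for y
  proof -
    obtain w where w: "y = word_prod w" "legs_in D (ring_B \<tau>) w" "1 \<le> length (filter isl w)"
      using y by blast
    from w(2) obtain a b where "word_prod w = mixed_product (length (filter isl w)) a b"
      "\<forall>i\<in>{1..length (filter isl w)}. a i \<in> D"
      by (rule word_prod_eq_mixed_product)
    with assms(3)[OF w(3)] w(1) show ?thesis by simp
  qed
qed

end

section \<open>Coordinates, trace and state on finite rank endomorphisms\<close>

abbreviation hamel_basis :: "'v::complex_vector set" where
  "hamel_basis \<equiv> cvec.extend_basis {}"

abbreviation coord :: "'v::complex_vector \<Rightarrow> 'v \<Rightarrow> complex" where
  "coord x b \<equiv> cvec.representation hamel_basis x b"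

lemma independent_hamel_basis: "cvec.independent hamel_basis"
  by (rule cvec.independent_extend_basis[OF cvec.independent_empty])

lemma span_hamel_basis: "cvec.span hamel_basis = UNIV"
  by (rule cvec.span_extend_basis[OF cvec.independent_empty])

lemma clinear_coord: "clinear (\<lambda>x. coord x b)"
  by (rule clinearI)
    (simp_all add: cvec.representation_add cvec.representation_scale independent_hamel_basis
      span_hamel_basis scaleC_complex_def)

lemma finite_coord_support: "finite {b. coord x b \<noteq> 0}"
  by (rule cvec.finite_representation)

lemma coord_eq_0_outside: "b \<notin> hamel_basis \<Longrightarrow> coord x b = 0"
  using cvec.representation_ne_zero by blast

lemma sum_coord_superset:
  assumes "finite S" "{b. coord x b \<noteq> 0} \<subseteq> S"
  shows "(\<Sum>b\<in>S. coord x b *\<^sub>C b) = x"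
proof -
  have "(\<Sum>b\<in>S. coord x b *\<^sub>C b) = (\<Sum>b | coord x b \<noteq> 0. coord x b *\<^sub>C b)"
    by (rule sum.mono_neutral_right) (use assms in auto)
  also have "\<dots> = x"
    by (rule cvec.sum_nonzero_representation_eq) (simp_all add: independent_hamel_basis span_hamel_basis)
  finally show ?thesis .
qed

lemma coord_eq_0_imp: "(\<And>b. coord x b = 0) \<Longrightarrow> x = 0"
  using sum_coord_superset[of "{}" x] by simp

lemma clinear_apply_endo: "clinear (apply_endo T)"
  using apply_endo[of T] by simp

text \<open>
  One finite set of basis vectors supports the whole range of an operator of finite rank, so that traces
  of several operators can be compared as sums over a common index set.
\<close>

lemma finite_rank_coord_support:
  obtains S where "finite S" "\<And>x. {b. coord (apply_endo T x) b \<noteq> 0} \<subseteq> S"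
proof -
  obtain F where F: "finite F" "range (apply_endo T) \<subseteq> cvec.span F"
    using apply_endo[of T] by (auto simp: finite_rank_def)
  let ?S = "\<Union>x\<in>F. {b. coord x b \<noteq> 0}" and ?Z = "\<lambda>S. {y. \<forall>b. b \<notin> S \<longrightarrow> coord y b = 0}"
  have "cvec.subspace (?Z ?S)"
    by (rule cvec.subspaceI)
      (auto simp: clinear_0[OF clinear_coord] clinear_add[OF clinear_coord] clinear_scale[OF clinear_coord]
        scaleC_complex_def)
  then have "cvec.span F \<subseteq> ?Z ?S"
    by (rule cvec.span_minimal[rotated]) auto
  then have "{b. coord (apply_endo T x) b \<noteq> 0} \<subseteq> ?S" for x
    using F(2) by blast
  moreover have "finite ?S"
    using F(1) finite_coord_support by auto
  ultimately show thesis using that by blast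
qed

lemma Tr_eq_sum:
  assumes "finite S" "\<And>x. {b. coord (apply_endo T x) b \<noteq> 0} \<subseteq> S"
  shows "Tr T = (\<Sum>b\<in>S. coord (apply_endo T b) b)"
  unfolding Tr_def Let_def
  by (rule sum.mono_neutral_left) (use assms coord_eq_0_outside in blast)+

lemma clinear_Tr: "clinear Tr"
proof (rule clinearI)
  fix T U :: "'a end_fin" and c
  obtain S where S: "finite S" "\<And>x. {b. coord (apply_endo T x) b \<noteq> 0} \<subseteq> S"
    by (rule finite_rank_coord_support[of T]) (rule that)
  obtain S' where S': "finite S'" "\<And>x. {b. coord (apply_endo U x) b \<noteq> 0} \<subseteq> S'"
    by (rule finite_rank_coord_support[of U]) (rule that)
  note coord_lin = clinear_add[OF clinear_coord] clinear_scale[OF clinear_coord]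
  let ?S = "S \<union> S'"
  have "Tr (T + U) = (\<Sum>b\<in>?S. coord (apply_endo (T + U) b) b)"
  proof (rule Tr_eq_sum)
    show "finite ?S" using S(1) S'(1) by simp
    show "{b. coord (apply_endo (T + U) x) b \<noteq> 0} \<subseteq> ?S" for x
    proof (rule subsetI, rule ccontr)
      fix b assume b: "b \<in> {b. coord (apply_endo (T + U) x) b \<noteq> 0}" "b \<notin> ?S"
      then have "coord (apply_endo T x) b = 0" "coord (apply_endo U x) b = 0"
        using S(2)[of x] S'(2)[of x] by blast+
      with b(1) show False by (simp add: plus_end_fin.rep_eq coord_lin)
    qed
  qed
  also have "\<dots> = (\<Sum>b\<in>?S. coord (apply_endo T b) b) + (\<Sum>b\<in>?S. coord (apply_endo U b) b)"
    by (simp add: plus_end_fin.rep_eq coord_lin sum.distrib)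
  also have "\<dots> = Tr T + Tr U"
    using Tr_eq_sum[of ?S T] Tr_eq_sum[of ?S U] S S' by (simp add: le_supI1 le_supI2)
  finally show "Tr (T + U) = Tr T + Tr U" .
  have "Tr (c *\<^sub>C T) = (\<Sum>b\<in>S. coord (apply_endo (c *\<^sub>C T) b) b)"
    by (rule Tr_eq_sum) (use S in \<open>auto simp: scaleC_end_fin.rep_eq coord_lin scaleC_complex_def subset_iff\<close>)
  then show "Tr (c *\<^sub>C T) = c *\<^sub>C Tr T"
    by (simp add: Tr_eq_sum[OF S] scaleC_end_fin.rep_eq coord_lin scaleC_complex_def sum_distrib_left)
qed

lemma apply_endo_rank_one:
  assumes "clinear f"
  shows "apply_endo (rank_one f h) x = f x *\<^sub>C h"
proof -
  have "finite_rank (\<lambda>x. f x *\<^sub>C h)"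
    unfolding finite_rank_def
    by (rule exI[of _ "{h}"]) (auto intro: cvec.span_scale cvec.span_base)
  moreover have "clinear (\<lambda>x. f x *\<^sub>C h)"
    by (rule clinearI) (simp_all add: clinear_add[OF assms] clinear_scale[OF assms] scaleC_add_left
        scaleC_scaleC scaleC_complex_def)
  ultimately show ?thesis
    by (simp add: rank_one_def Abs_end_fin_inverse)
qed

lemma end_fin_eqI: "(\<And>x. apply_endo T x = apply_endo U x) \<Longrightarrow> T = U"
  using apply_endo_inject by blast

lemma rank_one_linear_simps:
  "clinear f \<Longrightarrow> rank_one f (h + h') = rank_one f h + rank_one f h'"
  "clinear f \<Longrightarrow> rank_one f (c *\<^sub>C h) = c *\<^sub>C rank_one f h"
  by (rule end_fin_eqI, simp add: apply_endo_rank_one plus_end_fin.rep_eq scaleC_end_fin.rep_eq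
      scaleC_add_right scaleC_scaleC mult.commute)+

text \<open>
  The diagonal entries of \<open>x \<mapsto> f x *\<^sub>C h\<close> are \<open>f b\<close> times the coordinates of \<open>h\<close>; their sum is \<open>f\<close> applied to
  the expansion of \<open>h\<close>.
\<close>

lemma Tr_rank_one:
  assumes "clinear f"
  shows "Tr (rank_one f h) = f h"
proof -
  let ?S = "{b. coord h b \<noteq> 0}"
  note coord_lin = clinear_add[OF clinear_coord] clinear_scale[OF clinear_coord]
  have "Tr (rank_one f h) = (\<Sum>b\<in>?S. coord (apply_endo (rank_one f h) b) b)"
    by (rule Tr_eq_sum[OF finite_coord_support])
      (auto simp: apply_endo_rank_one[OF assms] coord_lin scaleC_complex_def)
  also have "\<dots> = f (\<Sum>b\<in>?S. coord h b *\<^sub>C b)"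
    by (simp add: apply_endo_rank_one[OF assms] coord_lin clinear_sum[OF assms]
        clinear_scale[OF assms] scaleC_complex_def mult.commute)
  also have "\<dots> = f h"
    by (simp add: sum_coord_superset[OF finite_coord_support])
  finally show ?thesis .
qed

lemma apply_endo_sum: "apply_endo (sum T S) x = (\<Sum>b\<in>S. apply_endo (T b) x)"
  by (induction S rule: infinite_finite_induct) (simp_all add: zero_end_fin.rep_eq plus_end_fin.rep_eq)

text \<open>
  Expanding the values \<open>T x\<close> in a Hamel basis writes \<open>T\<close> through the rank one operators of its coordinate
  functionals.
\<close>

lemma end_fin_eq_sum_rank_one:
  obtains S f where "finite S" "\<And>b. clinear (f b)" "T = (\<Sum>b\<in>S. rank_one (f b) b)"
proof -
  obtain S where S: "finite S" "\<And>x. {b. coord (apply_endo T x) b \<noteq> 0} \<subseteq> S"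
    by (rule finite_rank_coord_support[of T]) (rule that)
  let ?f = "\<lambda>b x. coord (apply_endo T x) b"
  have lin: "clinear (?f b)" for b
    by (rule clinearI) (simp_all add: clinear_add[OF clinear_apply_endo] clinear_scale[OF clinear_apply_endo]
        clinear_add[OF clinear_coord] clinear_scale[OF clinear_coord])
  have "T = (\<Sum>b\<in>S. rank_one (?f b) b)"
    by (rule end_fin_eqI) (simp add: apply_endo_sum apply_endo_rank_one[OF lin] sum_coord_superset[OF S])
  with S(1) lin show thesis by (rule that)
qed

text \<open>
  Evaluation at \<open>1\<close> followed by \<open>\<tau>\<close> has the defining property of \<open>\<psi>\<close>, and the rank one operators span.
\<close>

lemma psi_eq:
  fixes \<tau> :: "'b::unital_complex_star_algebra \<Rightarrow> complex"
  assumes "clinear \<tau>"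
  shows "psi \<tau> = (\<lambda>T. \<tau> (apply_endo T 1))"
  unfolding psi_def
proof (rule the_equality)
  show "clinear (\<lambda>T. \<tau> (apply_endo T 1)) \<and>
      (\<forall>f h. clinear f \<longrightarrow> \<tau> (apply_endo (rank_one f h) 1) = f 1 * \<tau> h)"
    by (auto intro!: clinearI simp: plus_end_fin.rep_eq scaleC_end_fin.rep_eq clinear_add[OF assms]
        clinear_scale[OF assms] apply_endo_rank_one scaleC_complex_def)
  fix p :: "'b end_fin \<Rightarrow> complex" assume p: "clinear p \<and> (\<forall>f h. clinear f \<longrightarrow> p (rank_one f h) = f 1 * \<tau> h)"
  show "p = (\<lambda>T. \<tau> (apply_endo T 1))"
  proof
    fix T :: "'b end_fin"
    obtain S f where "finite S" and f: "\<And>b. clinear (f b)" and T: "T = (\<Sum>b\<in>S. rank_one (f b) b)"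
      by (rule end_fin_eq_sum_rank_one[of T]) blast
    show "p T = \<tau> (apply_endo T 1)"
      using p f by (simp add: T clinear_sum apply_endo_sum clinear_sum[OF assms]
          apply_endo_rank_one clinear_scale[OF assms] scaleC_complex_def)
  qed
qed

lemma clinear_psi: "clinear \<tau> \<Longrightarrow> clinear (psi \<tau>)"
  by (rule clinearI) (simp_all add: psi_eq plus_end_fin.rep_eq scaleC_end_fin.rep_eq clinear_add clinear_scale)

lemma psi_rank_one: "clinear \<tau> \<Longrightarrow> clinear f \<Longrightarrow> psi \<tau> (rank_one f h) = f 1 * \<tau> h"
  by (simp add: psi_eq apply_endo_rank_one clinear_scale scaleC_complex_def)

section \<open>Separation of tensors and representation of functionals\<close>

definition left_coord :: "'v::complex_vector \<Rightarrow> ('v, 'w::complex_vector) tensor \<Rightarrow> 'w" where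
  "left_coord b = tensor_lift (\<lambda>v w. coord v b *\<^sub>C w)"

lemma
  fixes b v :: "'a::complex_vector" and w :: "'b::complex_vector"
  shows clinear_left_coord: "clinear (left_coord b :: ('a, 'b) tensor \<Rightarrow> 'b)"
    and left_coord_pure: "left_coord b (v \<otimes> w) = coord v b *\<^sub>C w"
proof -
  have bil: "cbilinear (\<lambda>v w. coord v b *\<^sub>C (w :: 'b))"
    by (auto simp: cbilinear_def clinear_add[OF clinear_coord] clinear_scale[OF clinear_coord]
        scaleC_add_right scaleC_add_left scaleC_scaleC scaleC_complex_def mult.commute intro!: clinearI)
  show "clinear (left_coord b :: ('a, 'b) tensor \<Rightarrow> 'b)"
    unfolding left_coord_def by (rule clinear_tensor_lift[OF bil])
  show "left_coord b (v \<otimes> w) = coord v b *\<^sub>C w"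
    unfolding left_coord_def by (rule tensor_lift_pure[OF bil])
qed

text \<open>
  The expansion holds for pure tensors. To pass to sums, the predicate \<open>P\<close> demands it for every finite
  index set beyond \<open>S\<close>: two tensors then share the union of their index sets.
\<close>

lemma tensor_eq_sum_left_coord:
  obtains S where "finite S" "t = (\<Sum>b\<in>S. b \<otimes> left_coord b t)"
proof -
  define P where "P t S \<longleftrightarrow> finite S \<and> (\<forall>S'. finite S' \<longrightarrow> S \<subseteq> S' \<longrightarrow> t = (\<Sum>b\<in>S'. b \<otimes> left_coord b t))"
    for t :: "('a, 'b) tensor" and S
  have "cvec.subspace {t. \<exists>S. P t S}"
  proof (rule cvec.subspaceI)
    show "0 \<in> {t. \<exists>S. P t S}"
      by (auto simp: P_def clinear_0[OF clinear_left_coord])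
    fix s t assume "s \<in> {t. \<exists>S. P t S}" "t \<in> {t. \<exists>S. P t S}"
    then obtain S S' where S: "P s S" "P t S'" by blast
    have "P (s + t) (S \<union> S')"
      unfolding P_def
    proof (intro conjI allI impI)
      fix R assume R: "finite R" "S \<union> S' \<subseteq> R"
      have "s = (\<Sum>b\<in>R. b \<otimes> left_coord b s)" "t = (\<Sum>b\<in>R. b \<otimes> left_coord b t)"
        using S R unfolding P_def by blast+
      then have "s + t = (\<Sum>b\<in>R. b \<otimes> left_coord b s) + (\<Sum>b\<in>R. b \<otimes> left_coord b t)"
        by (rule arg_cong2)
      also have "\<dots> = (\<Sum>b\<in>R. b \<otimes> left_coord b (s + t))"
        by (simp only: clinear_add[OF clinear_left_coord] pure_tensor_add_right sum.distrib)
      finally show "s + t = (\<Sum>b\<in>R. b \<otimes> left_coord b (s + t))" .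
    qed (use S in \<open>simp add: P_def\<close>)
    then show "s + t \<in> {t. \<exists>S. P t S}" by blast
  next
    fix c t assume "t \<in> {t. \<exists>S. P t S}"
    then obtain S where S: "P t S" by blast
    have "P (c *\<^sub>C t) S"
      unfolding P_def
    proof (intro conjI allI impI)
      fix R assume R: "finite R" "S \<subseteq> R"
      then have "t = (\<Sum>b\<in>R. b \<otimes> left_coord b t)"
        using S unfolding P_def by blast
      then have "c *\<^sub>C t = c *\<^sub>C (\<Sum>b\<in>R. b \<otimes> left_coord b t)"
        by (rule arg_cong)
      also have "\<dots> = (\<Sum>b\<in>R. b \<otimes> left_coord b (c *\<^sub>C t))"
        by (simp only: clinear_scale[OF clinear_left_coord] pure_tensor_scale_right cvec.scale_sum_right)
      finally show "c *\<^sub>C t = (\<Sum>b\<in>R. b \<otimes> left_coord b (c *\<^sub>C t))" .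
    qed (use S in \<open>simp add: P_def\<close>)
    then show "c *\<^sub>C t \<in> {t. \<exists>S. P t S}" by blast
  qed
  moreover have "P (v \<otimes> w) {b. coord v b \<noteq> 0}" for v w
    unfolding P_def
  proof (intro conjI allI impI)
    fix R assume R: "finite R" "{b. coord v b \<noteq> 0} \<subseteq> R"
    have "(\<Sum>b\<in>R. b \<otimes> left_coord b (v \<otimes> w)) = (\<Sum>b\<in>R. coord v b *\<^sub>C b) \<otimes> w"
      by (simp add: left_coord_pure pure_tensor_scale_right pure_tensor_scale_left
          clinear_sum[OF clinear_pure_tensor_left])
    then show "v \<otimes> w = (\<Sum>b\<in>R. b \<otimes> left_coord b (v \<otimes> w))"
      by (simp add: sum_coord_superset[OF R])
  qed (rule finite_coord_support)
  ultimately have "cvec.span (range (\<lambda>(v, w). v \<otimes> w)) \<subseteq> {t. \<exists>S. P t S}"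
    by (intro cvec.span_minimal) auto
  then obtain S where "P t S"
    by (auto simp: span_pure_tensors)
  then show thesis using that unfolding P_def by blast
qed

lemma tensor_eq_0I:
  assumes "\<And>b. left_coord b t = 0"
  shows "t = 0"
proof -
  obtain S where "t = (\<Sum>b\<in>S. b \<otimes> left_coord b t)"
    by (rule tensor_eq_sum_left_coord)
  then show ?thesis by (simp add: assms)
qed

text \<open>
  The map \<open>\<theta>\<close> collects the values of \<open>\<tau>(h \<cdot>)\<close> on a finite basis \<open>B\<close> into a vector. It is an injective
  endomorphism of a finite-dimensional space by nondegeneracy, hence surjective, and so the values of
  \<open>f\<close> on \<open>B\<close> are attained by some \<open>h\<close>.
\<close>

lemma nondegenerate_functional_representation:
  fixes \<tau> :: "'b::unital_complex_star_algebra \<Rightarrow> complex"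
  assumes \<tau>: "clinear \<tau>" and nondeg: "\<And>h. (\<And>x. \<tau> (h * x) = 0) \<Longrightarrow> h = 0"
    and F: "finite F" "cvec.span F = (UNIV :: 'b set)" and f: "clinear f"
  obtains h where "f = (\<lambda>x. \<tau> (h * x))"
proof -
  obtain B where B: "B \<subseteq> F" "cvec.independent B" "F \<subseteq> cvec.span B"
    using cvec.maximal_independent_subset by blast
  have fin: "finite B"
    using B(1) F(1) by (rule finite_subset)
  have span: "cvec.span B = UNIV"
    using cvec.span_minimal[OF B(3) cvec.subspace_span] F(2) by blast
  interpret fd: finite_dimensional_vector_space "scaleC :: complex \<Rightarrow> 'b \<Rightarrow> 'b" B
    by unfold_locales (use fin B(2) span in auto)
  have eqI: "g = g'" if "clinear g" "clinear g'" "\<And>b. b \<in> B \<Longrightarrow> g b = g' b" for g g' :: "'b \<Rightarrow> complex"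
  proof
    fix x show "g x = g' x"
      by (rule linear_on_eq_on_span[OF cvec.subspace_UNIV subset_UNIV that(1,2,3)])
        (use span in blast)+
  qed
  have lin: "clinear (\<lambda>x. \<tau> (h * x))" "clinear (\<lambda>h. \<tau> (h * x))" for h x
    by (auto intro!: clinearI simp: distrib_left distrib_right mult_scaleC_left mult_scaleC_right
        clinear_add[OF \<tau>] clinear_scale[OF \<tau>])
  define \<theta> where "\<theta> h = (\<Sum>b\<in>B. \<tau> (h * b) *\<^sub>C b)" for h
  have \<theta>_lin: "clinear \<theta>"
    by (rule clinearI) (simp_all add: \<theta>_def clinear_add[OF lin(2)] clinear_scale[OF lin(2)]
        scaleC_add_left sum.distrib cvec.scale_sum_right scaleC_scaleC scaleC_complex_def)
  have "h = 0" if "\<theta> h = 0" for h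
  proof (rule nondeg)
    have "\<tau> (h * b) = 0" if "b \<in> B" for b
      using cvec.independentD[OF B(2) fin order_refl \<open>\<theta> h = 0\<close>[unfolded \<theta>_def] that] .
    then have "(\<lambda>x. \<tau> (h * x)) = (\<lambda>_. 0)"
      by (intro eqI lin(1)) (auto simp: clinear_0 intro!: clinearI)
    then show "\<tau> (h * x) = 0" for x by metis
  qed
  then have "inj \<theta>"
    by (auto intro!: injI) (metis \<theta>_lin clinear_diff eq_iff_diff_eq_0)
  then have "surj \<theta>"
    using fd.linear_inj_imp_surj \<theta>_lin unfolding clinear_iff_linear by blast
  then obtain h where h: "(\<Sum>b\<in>B. f b *\<^sub>C b) = \<theta> h"
    by (metis surjD)
  then have "(\<Sum>b\<in>B. (f b - \<tau> (h * b)) *\<^sub>C b) = 0"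
    by (simp add: \<theta>_def cvec.scale_left_diff_distrib sum_subtractf)
  then have "f b = \<tau> (h * b)" if "b \<in> B" for b
    using cvec.independentD[OF B(2) fin order_refl _ that] by fastforce
  then have "f = (\<lambda>x. \<tau> (h * x))"
    by (intro eqI f lin(1))
  then show thesis by (rule that)
qed

section \<open>The map to finite rank endomorphisms\<close>

context measure_and_probability_space
begin

abbreviation BDB_space :: "('b, ('a, 'b) tensor) tensor set" where
  "BDB_space \<equiv> tensor_subspace UNIV (tensor_subspace D UNIV)"

abbreviation DEnd_space :: "('a, 'b end_fin) tensor set" where
  "DEnd_space \<equiv> tensor_subspace D UNIV"

lemma clinear_\<tau>_mult: "clinear (\<lambda>x. \<tau> (h * x))"
  by (rule clinearI) (simp_all add: distrib_left mult_scaleC_right clinear_add[OF \<tau>_linear]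
      clinear_scale[OF \<tau>_linear])

definition to_endo :: "('b, ('a, 'b) tensor) tensor \<Rightarrow> ('a, 'b end_fin) tensor" where
  "to_endo = tensor_lift3 (\<lambda>h a k. a \<otimes> rank_one (\<lambda>x. \<tau> (h * x)) k)"

lemma
  shows clinear_to_endo: "clinear to_endo"
    and to_endo_pure: "to_endo (h \<otimes> a \<otimes> k) = a \<otimes> rank_one (\<lambda>x. \<tau> (h * x)) k"
proof -
  have rank_one_left: "rank_one (\<lambda>x. \<tau> ((h + h') * x)) k
      = rank_one (\<lambda>x. \<tau> (h * x)) k + rank_one (\<lambda>x. \<tau> (h' * x)) k"
    "rank_one (\<lambda>x. \<tau> ((c *\<^sub>C h) * x)) k = c *\<^sub>C rank_one (\<lambda>x. \<tau> (h * x)) k" for h h' k c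
    by (rule end_fin_eqI, simp only: apply_endo_rank_one[OF clinear_\<tau>_mult] plus_end_fin.rep_eq
        scaleC_end_fin.rep_eq, simp add: distrib_right mult_scaleC_left clinear_add[OF \<tau>_linear]
        clinear_scale[OF \<tau>_linear] scaleC_add_left scaleC_scaleC scaleC_complex_def)+
  have tri: "ctrilinear (\<lambda>h (a :: 'a) k. a \<otimes> rank_one (\<lambda>x. \<tau> (h * x)) k)"
    by (intro ctrilinearI clinearI)
      (simp_all only: rank_one_linear_simps[OF clinear_\<tau>_mult] rank_one_left pure_tensor_linear_simps)
  show "clinear to_endo"
    unfolding to_endo_def by (rule clinear_tensor_lift3[OF tri])
  show "to_endo (h \<otimes> a \<otimes> k) = a \<otimes> rank_one (\<lambda>x. \<tau> (h * x)) k"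
    unfolding to_endo_def by (rule tensor_lift3_pure[OF tri])
qed

lemma pure_in_BDB: "a \<in> D \<Longrightarrow> h \<otimes> a \<otimes> k \<in> BDB_space"
  unfolding tensor_subspace3_eq_span by (rule cvec.span_base) auto

lemma subspace_BDB: "cvec.subspace BDB_space"
  unfolding tensor_subspace_def by (rule cvec.subspace_span)

lemma pure_in_DEnd: "a \<in> D \<Longrightarrow> a \<otimes> T \<in> DEnd_space"
  unfolding tensor_subspace_def by (rule cvec.span_base) auto

lemma to_endo_image_subset: "to_endo ` BDB_space \<subseteq> DEnd_space"
proof -
  let ?G = "{h \<otimes> a \<otimes> k | h a k. h \<in> (UNIV :: 'b set) \<and> a \<in> D \<and> k \<in> (UNIV :: 'b set)}"
  have "to_endo t \<in> DEnd_space" if "t \<in> ?G" for t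
    using that pure_in_DEnd by (auto simp: to_endo_pure)
  then show ?thesis
    unfolding tensor_subspace3_eq_span tensor_subspace_def[of D "UNIV :: 'b end_fin set"]
    using clinear_image_span_subset[OF clinear_to_endo] by blast
qed

lemma faithful_nondegenerate:
  assumes "faithful \<tau>" "\<And>x. \<tau> (h * x) = 0"
  shows "h = 0"
  using assms \<tau>_trace unfolding faithful_def by metis

text \<open>
  If \<open>t\<close> is mapped to zero, then so are all numbers obtained from the image by taking a coordinate \<open>a0\<close>
  of the leg in \<open>\<A>\<close> and a coordinate \<open>k0\<close> of the value of the operator at \<open>x\<close>. Such a number is
  \<open>\<tau>(contract t * x)\<close>, where \<open>contract t\<close> takes the two coordinates of the contract two legs of \<open>t\<close> and keeps the
  first leg. By faithfulness \<open>contract t\<close> is zero for all \<open>a0\<close> and \<open>k0\<close>, which means that all coordinates of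
  \<open>t\<close> vanish.
\<close>

lemma inj_to_endo:
  assumes "faithful \<tau>"
  shows "inj to_endo"
proof -
  have kernel: "t = 0" if t: "to_endo t = 0" for t
  proof (rule tensor_eq_0I, rule tensor_eq_0I, rule coord_eq_0_imp)
    fix h0 a0 k0
    define contract where "contract = tensor_lift3 (\<lambda>(h::'b) (a::'a) (k::'b). (coord a a0 * coord k k0) *\<^sub>C h)"
    have tri: "ctrilinear (\<lambda>(h::'b) (a::'a) (k::'b). (coord a a0 * coord k k0) *\<^sub>C h)"
      by (intro ctrilinearI clinearI)
        (simp_all add: clinear_add[OF clinear_coord] clinear_scale[OF clinear_coord] scaleC_add_left
          scaleC_add_right scaleC_scaleC scaleC_complex_def distrib_left distrib_right mult_ac)
    note contract = clinear_tensor_lift3[OF tri, folded contract_def] tensor_lift3_pure[OF tri, folded contract_def]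
    have "\<tau> (contract t * x) = 0" for x
    proof -
      define entry where "entry = tensor_lift (\<lambda>(a::'a) (T::'b end_fin). coord a a0 * coord (apply_endo T x) k0)"
      have bil: "cbilinear (\<lambda>(a::'a) (T::'b end_fin). coord a a0 * coord (apply_endo T x) k0)"
        by (auto simp: cbilinear_def clinear_add[OF clinear_coord] clinear_scale[OF clinear_coord]
            plus_end_fin.rep_eq scaleC_end_fin.rep_eq scaleC_complex_def algebra_simps intro!: clinearI)
      note entry = clinear_tensor_lift[OF bil, folded entry_def] tensor_lift_pure[OF bil, folded entry_def]
      have "\<tau> (contract t * x) = entry (to_endo t)"
        by (rule clinear_eq_on_pure_triples)
          (auto intro!: clinearI simp: clinear_add[OF contract(1)] clinear_scale[OF contract(1)]
            clinear_add[OF entry(1)] clinear_scale[OF entry(1)] clinear_add[OF clinear_to_endo]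
            clinear_scale[OF clinear_to_endo] clinear_add[OF \<tau>_linear] clinear_scale[OF \<tau>_linear]
            distrib_right mult_scaleC_left contract(2) to_endo_pure entry(2)
            apply_endo_rank_one[OF clinear_\<tau>_mult] clinear_scale[OF clinear_coord] scaleC_complex_def)
      then show ?thesis by (simp add: t clinear_0[OF entry(1)])
    qed
    then have "contract t = 0"
      by (rule faithful_nondegenerate[OF assms])
    moreover have "coord (left_coord a0 (left_coord h0 t)) k0 = coord (contract t) h0"
      by (rule clinear_eq_on_pure_triples)
        (auto intro!: clinearI simp: clinear_add[OF contract(1)] clinear_scale[OF contract(1)]
          clinear_add[OF clinear_left_coord] clinear_scale[OF clinear_left_coord]
          clinear_add[OF clinear_coord] clinear_scale[OF clinear_coord] left_coord_pure contract(2)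
          scaleC_complex_def)
    ultimately show "coord (left_coord a0 (left_coord h0 t)) k0 = 0"
      by (simp add: clinear_0[OF clinear_coord])
  qed
  show ?thesis
  proof (rule injI)
    fix s t assume "to_endo s = to_endo t"
    then have "to_endo (s - t) = 0"
      by (simp add: clinear_diff[OF clinear_to_endo])
    then have "s - t = 0" by (rule kernel)
    then show "s = t" by simp
  qed
qed

text \<open>
  In finite dimension every functional on \<open>\<B>\<close> has the form \<open>\<tau>(h \<cdot>)\<close>, so all rank one operators, and with
  them all operators, are reached.
\<close>

lemma to_endo_surj:
  assumes "faithful \<tau>" "finite F" "cvec.span F = (UNIV :: 'b set)"
  shows "DEnd_space \<subseteq> to_endo ` BDB_space"
proof -
  have pure: "a \<otimes> T \<in> to_endo ` BDB_space" if a: "a \<in> D" for a T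
  proof -
    obtain S f where S: "finite S" and f: "\<And>b. clinear (f b)" and T: "T = (\<Sum>b\<in>S. rank_one (f b) b)"
      by (rule end_fin_eq_sum_rank_one[of T]) (rule that)
    have "\<exists>h. f b = (\<lambda>x. \<tau> (h * x))" for b
    proof -
      obtain h where "f b = (\<lambda>x. \<tau> (h * x))"
        by (rule nondegenerate_functional_representation[OF \<tau>_linear faithful_nondegenerate[OF assms(1)]
              assms(2,3) f[of b]]) (blast, rule that)
      then show ?thesis by blast
    qed
    then obtain h where h: "\<And>b. f b = (\<lambda>x. \<tau> (h b * x))"
      by metis
    have "to_endo (\<Sum>b\<in>S. h b \<otimes> a \<otimes> b) = a \<otimes> T"
      unfolding T clinear_sum[OF clinear_to_endo] to_endo_pure clinear_sum[OF clinear_pure_tensor_right]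
      by (simp only: h)
    moreover have "(\<Sum>b\<in>S. h b \<otimes> a \<otimes> b) \<in> BDB_space"
      by (intro cvec.subspace_sum subspace_BDB pure_in_BDB a)
    ultimately show ?thesis
      by (rule rev_image_eqI[OF _ sym, rotated])
  qed
  have "cvec.subspace (to_endo ` BDB_space)"
    using cvec_pair.linear_subspace_image clinear_to_endo subspace_BDB unfolding clinear_iff_linear by blast
  then show ?thesis
    unfolding tensor_subspace_def[of D "UNIV :: 'b end_fin set"]
    by (rule cvec.span_minimal[rotated]) (use pure in blast)
qed

section \<open>The quotient map\<close>

text \<open>
  Inverse to the collapsing map modulo \<open>J\<close>.
\<close>

definition sandwich :: "('b, ('a, 'b) tensor) tensor \<Rightarrow> ('a, 'b) free_product" where
  "sandwich = tensor_lift3 (\<lambda>h a k. incl_B h * incl_A a * incl_B k)"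

lemma
  shows clinear_sandwich: "clinear sandwich"
    and sandwich_pure: "sandwich (h \<otimes> a \<otimes> k) = incl_B h * incl_A a * incl_B k"
proof -
  have tri: "ctrilinear (\<lambda>h a k. incl_B h * incl_A a * incl_B k :: ('a, 'b) free_product)"
    by (intro ctrilinearI clinearI)
      (simp_all add: clinear_add[OF clinear_incl_A] clinear_scale[OF clinear_incl_A]
        clinear_add[OF clinear_incl_B] clinear_scale[OF clinear_incl_B]
        distrib_left distrib_right mult_scaleC_left mult_scaleC_right)
  show "clinear sandwich"
    unfolding sandwich_def by (rule clinear_tensor_lift3[OF tri])
  show "sandwich (h \<otimes> a \<otimes> k) = incl_B h * incl_A a * incl_B k"
    unfolding sandwich_def by (rule tensor_lift3_pure[OF tri])
qed

text \<open>
  That \<open>X\<close> inverts \<open>sandwich\<close> is its formula for \<open>n = 1\<close>. The converse relation, that \<open>sandwich (X x)\<close>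
  differs from \<open>x\<close> by an element of \<open>J\<close> for \<open>x\<close> in \<open>I\<close>, is linear in \<open>x\<close> and need only be checked on the
  generators of \<open>I\<close>: those in \<open>J\<close> are sent to \<open>0\<close>, the others are reproduced. These two relations yield
  the kernel and the image.
\<close>

lemma collapse_kernel_image:
  obtains X :: "('a, 'b) free_product \<Rightarrow> ('b, ('a, 'b) tensor) tensor"
  where "clinear X"
    "\<And>n a b. n \<ge> 1 \<Longrightarrow> X (mixed_product n a b) =
       (\<Prod>i\<in>{1..<n}. \<tau> (b i)) *\<^sub>C (b 0 \<otimes> nonempty_prod (map a [1..<Suc n]) \<otimes> b n)"
    "\<And>x. x \<in> \<J> \<Longrightarrow> X x = 0"
    "\<And>x. x \<in> \<I> \<Longrightarrow> X x = 0 \<Longrightarrow> x \<in> \<J>"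
    "\<And>h a k. X (incl_B h * incl_A a * incl_B k) = h \<otimes> a \<otimes> k"
    "X ` \<I> = BDB_space"
proof -
  obtain X :: "('a, 'b) free_product \<Rightarrow> ('b, ('a, 'b) tensor) tensor"
    where X: "clinear X"
    "\<And>n a b. n \<ge> 1 \<Longrightarrow> X (mixed_product n a b) =
       (\<Prod>i\<in>{1..<n}. \<tau> (b i)) *\<^sub>C (b 0 \<otimes> nonempty_prod (map a [1..<Suc n]) \<otimes> b n)"
    "\<And>x a b a' y. \<tau> b = 0 \<Longrightarrow> X (x * (incl_A a * incl_B b * incl_A a') * y) = 0"
    by (rule collapse_map[OF \<tau>_linear \<tau>_one]) (rule that)
  have X_sandwich: "X (incl_B h * incl_A a * incl_B k) = h \<otimes> a \<otimes> k" for h a k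
    using X(2)[of 1 "\<lambda>_. a" "\<lambda>i. if i = 0 then h else k"]
    by (simp add: mixed_product_def mult.assoc scaleC_one)
  have X_J: "X x = 0" if "x \<in> \<J>" for x
  proof (rule linear_on_eq_on_span[OF cvec.subspace_UNIV subset_UNIV X(1)])
    show "clinear (\<lambda>_. 0)" by (rule clinearI) simp_all
    show "x \<in> cvec.span {word_prod w | w.
        alternating w \<and> legs_in D (ring_B \<tau>) w \<and> 2 \<le> length (filter isl w)}"
      using that unfolding J_space_def .
  next
    fix x :: "('a, 'b) free_product"
    assume "x \<in> {word_prod w | w. alternating w \<and> legs_in D (ring_B \<tau>) w \<and> 2 \<le> length (filter isl w)}"
    then obtain w where w: "x = word_prod w" "alternating w" "legs_in D (ring_B \<tau>) w"
      "2 \<le> length (filter isl w)" by blast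
    obtain u a b a' v where uv: "w = u @ [Inl a, Inr b, Inl a'] @ v"
      using w(2,4) by (rule alternating_two_left_legs)
    have "\<tau> b = 0"
      using w(3) by (simp add: uv ring_B_def)
    then show "X x = 0"
      using X(3)[of b "word_prod u" a a' "word_prod v"] by (simp add: w(1) uv mult.assoc)
  qed
  have X_BDB: "X x \<in> BDB_space" and X_J_converse: "x - sandwich (X x) \<in> \<J>" if x: "x \<in> \<I>" for x
  proof -
    let ?Z = "{x. X x \<in> BDB_space \<and> x - sandwich (X x) \<in> \<J>}"
    have subspace_J: "cvec.subspace \<J>"
      unfolding J_space_eq_word_span by (rule subspace_word_span)
    have "cvec.subspace ?Z"
    proof (rule cvec.subspaceI)
      show "0 \<in> ?Z"
        by (simp add: clinear_0[OF X(1)] clinear_0[OF clinear_sandwich] cvec.subspace_0[OF subspace_J]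
            cvec.subspace_0[OF subspace_BDB])
      fix x y c assume x: "x \<in> ?Z"
      have "c *\<^sub>C x - sandwich (X (c *\<^sub>C x)) = c *\<^sub>C (x - sandwich (X x))"
        by (simp add: clinear_scale[OF X(1)] clinear_scale[OF clinear_sandwich] cvec.scale_right_diff_distrib)
      then show "c *\<^sub>C x \<in> ?Z"
        using x by (simp add: clinear_scale[OF X(1)] cvec.subspace_scale[OF subspace_J] cvec.subspace_scale[OF subspace_BDB])
      assume y: "y \<in> ?Z"
      have eq: "x + y - sandwich (X (x + y)) = (x - sandwich (X x)) + (y - sandwich (X y))"
        by (simp add: clinear_add[OF X(1)] clinear_add[OF clinear_sandwich])
      have "X (x + y) \<in> BDB_space"
        using x y by (simp add: clinear_add[OF X(1)] cvec.subspace_add[OF subspace_BDB])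
      moreover have "x + y - sandwich (X (x + y)) \<in> \<J>"
        unfolding eq using x y by (simp add: cvec.subspace_add[OF subspace_J])
      ultimately show "x + y \<in> ?Z" by simp
    qed
    moreover have "\<J> \<subseteq> ?Z"
      by (auto simp: X_J clinear_0[OF clinear_sandwich] cvec.subspace_0[OF subspace_BDB])
    moreover have sandwich_in: "incl_B h * incl_A a * incl_B k \<in> ?Z" if "a \<in> D" for h a k
      using that by (simp add: X_sandwich sandwich_pure pure_in_BDB cvec.subspace_0[OF subspace_J])
    moreover have "incl_A a \<in> ?Z" "incl_A a * incl_B k \<in> ?Z" "incl_B h * incl_A a \<in> ?Z" if "a \<in> D" for h a k
      using sandwich_in[OF that, of 1 1] sandwich_in[OF that, of 1 k] sandwich_in[OF that, of h 1]
      by (simp_all add: incl_B_one)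
    ultimately have "\<I> \<subseteq> ?Z"
      unfolding I_space_def by (intro cvec.span_minimal) auto
    then show "X x \<in> BDB_space" "x - sandwich (X x) \<in> \<J>"
      using x by auto
  qed
  show thesis
  proof (rule that[OF X(1,2) X_J _ X_sandwich])
    show "x \<in> \<J>" if "x \<in> \<I>" "X x = 0" for x
      using X_J_converse[OF that(1)] by (simp add: that(2) clinear_0[OF clinear_sandwich])
    have subspace_I: "cvec.subspace \<I>"
      unfolding I_space_eq_word_span by (rule subspace_word_span)
    have "cvec.subspace (X ` \<I>)"
      using cvec_pair.linear_subspace_image X(1) subspace_I unfolding clinear_iff_linear by blast
    moreover have "h \<otimes> a \<otimes> k \<in> X ` \<I>" if "a \<in> D" for h a k
      using X_sandwich[of h a k] sandwich_in_I[OF that, of h k] by (metis imageI)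
    ultimately have "BDB_space \<subseteq> X ` \<I>"
      unfolding tensor_subspace3_eq_span by (intro cvec.span_minimal) auto
    then show "X ` \<I> = BDB_space"
      using X_BDB by blast
  qed
qed

text \<open>
  The composition of \<open>X\<close> with \<open>G\<close> has the prescribed values by the formula for \<open>X\<close>, and these values leave
  no choice because the mixed products span \<open>I\<close>. The two products differ only in how they combine the outermost factors \<open>b\<^sub>0 = h\<close> and \<open>b\<^sub>n = k\<close>; the form
  \<open>\<beta> h k\<close> stands for \<open>\<tau> (k * h)\<close> or \<open>\<tau> h * \<tau> k\<close>.
\<close>

lemma product_functional_eq:
  assumes X: "clinear X"
    "\<And>n a b. n \<ge> 1 \<Longrightarrow> X (mixed_product n a b) =
       (\<Prod>i\<in>{1..<n}. \<tau> (b i)) *\<^sub>C (b 0 \<otimes> nonempty_prod (map a [1..<Suc n]) \<otimes> b n)"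
    and G: "clinear G" "\<And>h a k. a \<in> D \<Longrightarrow> G (h \<otimes> a \<otimes> k) = \<omega>0 a * \<beta> h k"
  shows "(THE \<omega>. \<omega> \<in> extensional \<I> \<and> linear_on \<I> \<omega> \<and>
     (\<forall>n\<ge>1. \<forall>a b. (\<forall>i\<in>{1..n}. a i \<in> D) \<longrightarrow>
        \<omega> (mixed_product n a b) =
          \<omega>0 (nonempty_prod (map a [1..<Suc n])) * (\<Prod>i\<in>{1..<n}. \<tau> (b i)) * \<beta> (b 0) (b n)))
    = restrict (\<lambda>x. G (X x)) \<I>" (is "(THE \<omega>. ?P \<omega>) = ?\<omega>")
proof (rule the_equality)
  have lin: "linear_on \<I> (\<lambda>x. G (X x))"
    by (simp add: linear_on_def clinear_add[OF X(1)] clinear_scale[OF X(1)] clinear_add[OF G(1)]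
        clinear_scale[OF G(1)])
  have subspace_I: "cvec.subspace \<I>"
    unfolding I_space_eq_word_span by (rule subspace_word_span)
  have in_D: "nonempty_prod (map a [1..<Suc n]) \<in> D" if "n \<ge> 1" "\<forall>i\<in>{1..n}. a i \<in> D" for n a
  proof -
    have "nonempty_prod xs \<in> D" if "xs \<noteq> []" "set xs \<subseteq> D" for xs
      using that by (induction xs rule: nonempty_prod.induct) (auto simp: D_mult)
    moreover have "map a [1..<Suc n] \<noteq> []" "set (map a [1..<Suc n]) \<subseteq> D"
      using that by auto
    ultimately show ?thesis by blast
  qed
  have val: "G (X (mixed_product n a b)) =
      \<omega>0 (nonempty_prod (map a [1..<Suc n])) * (\<Prod>i\<in>{1..<n}. \<tau> (b i)) * \<beta> (b 0) (b n)"
    if "n \<ge> 1" "\<forall>i\<in>{1..n}. a i \<in> D" for n a b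
    using in_D[OF that] by (simp add: X(2)[OF that(1)] clinear_scale[OF G(1)] G(2) scaleC_complex_def del: upt_Suc)
  show P: "?P ?\<omega>"
    using lin val mixed_product_in_I
    by (auto simp: linear_on_def cvec.subspace_add[OF subspace_I] cvec.subspace_scale[OF subspace_I] simp del: upt_Suc)
  fix \<omega> assume \<omega>: "?P \<omega>"
  show "\<omega> = ?\<omega>"
  proof (rule extensionalityI[of _ \<I>])
    show "\<omega> \<in> extensional \<I>" "?\<omega> \<in> extensional \<I>" using \<omega> P by blast+
    show "\<omega> x = ?\<omega> x" if "x \<in> \<I>" for x
    proof (rule linear_on_I_eq[OF _ _ _ that])
      show "linear_on \<I> \<omega>" "linear_on \<I> ?\<omega>" using \<omega> P by blast+
      show "\<omega> (mixed_product n a b) = ?\<omega> (mixed_product n a b)"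
        if "n \<ge> 1" "\<forall>i\<in>{1..n}. a i \<in> D" for n a b
        using \<omega> P that by (metis (no_types, lifting))
    qed
  qed
qed

text \<open>
  Both identities of the theorem in one: \<open>g\<close> is the trace or \<open>\<psi>\<close>, and \<open>\<beta>\<close> records its values on the rank
  one operators \<open>\<tau>(h \<cdot>) k\<close>.
\<close>

lemma tensor_functional_to_endo:
  assumes X: "clinear X"
    "\<And>n a b. n \<ge> 1 \<Longrightarrow> X (mixed_product n a b) =
       (\<Prod>i\<in>{1..<n}. \<tau> (b i)) *\<^sub>C (b 0 \<otimes> nonempty_prod (map a [1..<Suc n]) \<otimes> b n)"
    "X ` \<I> = BDB_space"
    and g: "clinear g" "\<And>h k. g (rank_one (\<lambda>x. \<tau> (h * x)) k) = \<beta> h k"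
    and x: "x \<in> \<I>"
  shows "tensor_functional D UNIV \<omega>0 g (to_endo (X x)) =
    (THE \<omega>. \<omega> \<in> extensional \<I> \<and> linear_on \<I> \<omega> \<and>
     (\<forall>n\<ge>1. \<forall>a b. (\<forall>i\<in>{1..n}. a i \<in> D) \<longrightarrow>
        \<omega> (mixed_product n a b) =
          \<omega>0 (nonempty_prod (map a [1..<Suc n])) * (\<Prod>i\<in>{1..<n}. \<tau> (b i)) * \<beta> (b 0) (b n))) x"
proof -
  obtain \<omega>0' where \<omega>0': "clinear \<omega>0'" "\<And>a. a \<in> D \<Longrightarrow> \<omega>0' a = \<omega>0 a"
    using linear_on_extension[OF D_subspace \<omega>0_linear] by blast
  have "cbilinear (\<lambda>a T. \<omega>0' a * g T)"
    using \<omega>0'(1) g(1) by (auto simp: cbilinear_def linear_on_def scaleC_complex_def algebra_simps)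
  note lift = clinear_tensor_lift[OF this] tensor_lift_pure[OF this]
  let ?G = "\<lambda>t. tensor_lift (\<lambda>a T. \<omega>0' a * g T) (to_endo t)"
  have G: "clinear ?G" "\<And>h a k. a \<in> D \<Longrightarrow> ?G (h \<otimes> a \<otimes> k) = \<omega>0 a * \<beta> h k"
    by (auto intro!: clinearI simp: clinear_add[OF lift(1)] clinear_scale[OF lift(1)]
        clinear_add[OF clinear_to_endo] clinear_scale[OF clinear_to_endo] to_endo_pure lift(2) g(2) \<omega>0'(2))
  have "to_endo (X x) \<in> DEnd_space"
    using x X(3) to_endo_image_subset by blast
  then show ?thesis
    using product_functional_eq[OF X(1,2) G] x tensor_functional_eq[OF \<omega>0' g(1)]
    by (simp del: upt_Suc)
qed

end

theorem theorem2p1: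
  fixes D :: "'a::complex_star_algebra set"
    and \<omega>0 :: "'a \<Rightarrow> complex"
    and \<tau> :: "'b::unital_complex_star_algebra \<Rightarrow> complex"
  defines "I \<equiv> I_space D \<tau>" and "J \<equiv> J_space D \<tau>"
    and "\<omega> \<equiv> cyclic_monotone_product D \<omega>0 \<tau>" and "\<omega>' \<equiv> monotone_product D \<omega>0 \<tau>"
    and "BDB \<equiv> tensor_subspace (UNIV :: 'b set) (tensor_subspace D (UNIV :: 'b set))"
    and "DEnd \<equiv> tensor_subspace D (UNIV :: 'b end_fin set)"
  assumes "nc_measure_space D \<omega>0" and "nc_probability_space \<tau>"
  shows "is_ideal_of J I \<and>
    (\<forall>x\<in>J. \<omega> x = 0) \<and> (\<forall>x\<in>J. \<omega>' x = 0) \<and>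
    (\<exists>(\<Phi> :: ('a, 'b) free_product set \<Rightarrow> ('b, ('a, 'b) tensor) tensor)
       (\<Psi> :: ('b, ('a, 'b) tensor) tensor \<Rightarrow> ('a, 'b end_fin) tensor)
       (\<chi> :: ('a, 'b) free_product \<Rightarrow> ('a, 'b end_fin) tensor).
      quotient_iso I J \<Phi> BDB \<and>
      (\<forall>a\<in>D. \<Phi> (coset J (incl_A a)) = 1 \<otimes> a \<otimes> 1) \<and>
      (\<forall>a\<in>D. \<forall>b\<in>ring_B \<tau>. \<Phi> (coset J (incl_A a * incl_B b)) = 1 \<otimes> a \<otimes> b) \<and>
      (\<forall>b\<in>ring_B \<tau>. \<forall>a\<in>D. \<Phi> (coset J (incl_B b * incl_A a)) = b \<otimes> a \<otimes> 1) \<and>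
      (\<forall>b\<in>ring_B \<tau>. \<forall>a\<in>D. \<forall>b'\<in>ring_B \<tau>.
         \<Phi> (coset J (incl_B b * incl_A a * incl_B b')) = b \<otimes> a \<otimes> b') \<and>
      linear_on BDB \<Psi> \<and> \<Psi> ` BDB \<subseteq> DEnd \<and>
      (\<forall>a\<in>D. \<forall>h1 h2. \<Psi> (h1 \<otimes> a \<otimes> h2) = a \<otimes> rank_one (\<lambda>x. \<tau> (h1 * x)) h2) \<and>
      (faithful \<tau> \<longrightarrow> inj_on \<Psi> BDB) \<and>
      (faithful \<tau> \<and> (\<exists>F :: 'b set. finite F \<and> cvec.span F = UNIV) \<longrightarrow> bij_betw \<Psi> BDB DEnd) \<and>
      (\<forall>x\<in>I. \<chi> x = \<Psi> (\<Phi> (coset J x))) \<and>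
      (\<forall>x\<in>I. tensor_functional D UNIV \<omega>0 Tr (\<chi> x) = \<omega> x) \<and>
      (\<forall>x\<in>I. tensor_functional D UNIV \<omega>0 (psi \<tau>) (\<chi> x) = \<omega>' x))"
proof -
  interpret measure_and_probability_space D \<omega>0 \<tau>
    by unfold_locales fact+
  let ?\<omega> = "cyclic_monotone_product D \<omega>0 \<tau>" and ?\<omega>' = "monotone_product D \<omega>0 \<tau>"
  obtain X :: "('a, 'b) free_product \<Rightarrow> ('b, ('a, 'b) tensor) tensor"
    where X: "clinear X"
    "\<And>n a b. n \<ge> 1 \<Longrightarrow> X (mixed_product n a b) =
       (\<Prod>i\<in>{1..<n}. \<tau> (b i)) *\<^sub>C (b 0 \<otimes> nonempty_prod (map a [1..<Suc n]) \<otimes> b n)"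
    and X_J: "\<And>x. x \<in> \<J> \<Longrightarrow> X x = 0" and X_kernel: "\<And>x. x \<in> \<I> \<Longrightarrow> X x = 0 \<Longrightarrow> x \<in> \<J>"
    and X_sandwich: "\<And>h a k. X (incl_B h * incl_A a * incl_B k) = h \<otimes> a \<otimes> k"
    and X_image: "X ` \<I> = BDB_space"
    by (rule collapse_kernel_image) (rule that)
  have ideal: "is_ideal_of \<J> \<I>"
    by (rule J_ideal_of_I)
  then have subspace_J: "cvec.subspace \<J>" and J_subset_I: "\<J> \<subseteq> \<I>"
    by (auto simp: is_ideal_of_def)
  have subspace_I: "cvec.subspace \<I>"
    unfolding I_space_eq_word_span by (rule subspace_word_span)
  \<comment> \<open>Independent of the chosen representative because \<open>X\<close> vanishes on \<open>J\<close>.\<close>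
  define \<Phi> where "\<Phi> C = X (SOME x. x \<in> C)" for C
  have \<Phi>_coset: "\<Phi> (coset \<J> x) = X x" for x
  proof -
    have "x \<in> coset \<J> x"
      using cvec.subspace_0[OF subspace_J] by (auto simp: coset_def intro: exI[of _ 0])
    then have "(SOME y. y \<in> coset \<J> x) \<in> coset \<J> x"
      by (rule someI)
    then show ?thesis
      by (auto simp: \<Phi>_def coset_def clinear_add[OF X(1)] X_J)
  qed
  have Tr: "tensor_functional D UNIV \<omega>0 Tr (to_endo (X x)) = ?\<omega> x" if "x \<in> \<I>" for x
    unfolding cyclic_monotone_product_def
    using tensor_functional_to_endo[OF X X_image clinear_Tr
        Tr_rank_one[OF clinear_\<tau>_mult] that]
    by (simp only: \<tau>_trace[of "_ 0"])
  have prod_ends: "(\<Prod>i\<in>{0..n}. \<tau> (b i)) = (\<Prod>i\<in>{1..<n}. \<tau> (b i)) * (\<tau> (b 0) * \<tau> (b n))"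
    if "n \<ge> 1" for n :: nat and b
  proof -
    have "{0..n} = insert 0 (insert n {1..<n})" using that by auto
    then show ?thesis using that by simp
  qed
  have psi: "tensor_functional D UNIV \<omega>0 (psi \<tau>) (to_endo (X x)) = ?\<omega>' x" if "x \<in> \<I>" for x
  proof -
    have "psi \<tau> (rank_one (\<lambda>x. \<tau> (h * x)) k) = \<tau> h * \<tau> k" for h k
      by (simp add: psi_rank_one[OF \<tau>_linear clinear_\<tau>_mult])
    note tensor_functional_to_endo[OF X X_image clinear_psi[OF \<tau>_linear]
        this that]
    then show ?thesis
      unfolding monotone_product_def by (simp only: prod_ends mult.assoc cong: imp_cong)
  qed
  have vanish: "tensor_functional D UNIV \<omega>0 g (to_endo (X x)) = 0" if "clinear g" "x \<in> \<J>" for g x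
  proof -
    obtain \<omega>0' where "clinear \<omega>0'" "\<And>a. a \<in> D \<Longrightarrow> \<omega>0' a = \<omega>0 a"
      using linear_on_extension[OF D_subspace \<omega>0_linear] by blast
    moreover from this(1) have "cbilinear (\<lambda>a T. \<omega>0' a * g T)"
      using that(1) by (auto simp: cbilinear_def linear_on_def scaleC_complex_def algebra_simps)
    moreover have "to_endo (X x) = 0"
      by (simp add: X_J[OF that(2)] clinear_0[OF clinear_to_endo])
    moreover have "0 \<in> tensor_subspace D (UNIV :: 'b end_fin set)"
      unfolding tensor_subspace_def by (rule cvec.span_zero)
    ultimately show ?thesis
      using tensor_functional_eq[OF _ _ that(1), of \<omega>0' D \<omega>0 0] clinear_0[OF clinear_tensor_lift] by simp
  qed
  have quot: "quotient_iso \<I> \<J> \<Phi> BDB_space"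
    unfolding quotient_iso_def bij_betw_def
  proof (intro conjI)
    show "inj_on \<Phi> (quotient_space \<I> \<J>)"
    proof (rule inj_onI)
      fix C C' assume "C \<in> quotient_space \<I> \<J>" "C' \<in> quotient_space \<I> \<J>" "\<Phi> C = \<Phi> C'"
      then obtain x y where xy: "C = coset \<J> x" "x \<in> \<I>" "C' = coset \<J> y" "y \<in> \<I>" "X x = X y"
        by (auto simp: quotient_space_def \<Phi>_coset)
      then have "X (x - y) = 0" "x - y \<in> \<I>"
        by (simp_all add: clinear_diff[OF X(1)] cvec.subspace_diff[OF subspace_I])
      then have d: "x - y \<in> \<J>" by (intro X_kernel)
      have "z - y \<in> \<J> \<longleftrightarrow> z - x \<in> \<J>" for z
        using cvec.subspace_add[OF subspace_J _ d, of "z - x"] cvec.subspace_diff[OF subspace_J _ d, of "z - y"] by auto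
      moreover have "coset \<J> x = {z. z - x \<in> \<J>}" for x
        by (auto simp: coset_def intro: exI[of _ "_ - x"])
      ultimately show "C = C'" using xy by simp
    qed
    show "\<Phi> ` quotient_space \<I> \<J> = BDB_space"
      by (simp add: quotient_space_def image_image \<Phi>_coset X_image)
    show "linear_on \<I> (\<lambda>x. \<Phi> (coset \<J> x))"
      using linear_on_mono[OF X(1) subset_UNIV] by (simp add: \<Phi>_coset)
  qed
  have X_incl: "X (incl_A a) = 1 \<otimes> a \<otimes> 1" "X (incl_A a * incl_B b) = 1 \<otimes> a \<otimes> b"
    "X (incl_B b * incl_A a) = b \<otimes> a \<otimes> 1" for a b
    using X_sandwich[of 1 a 1] X_sandwich[of 1 a b] X_sandwich[of b a 1] by (simp_all add: incl_B_one)
  have inj: "inj_on to_endo BDB_space" if "faithful \<tau>"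
    using inj_to_endo[OF that] by (rule inj_on_subset) simp
  have image: "to_endo ` BDB_space \<subseteq> DEnd_space"
    by (rule to_endo_image_subset)
  have bij: "bij_betw to_endo BDB_space DEnd_space" if "faithful \<tau>" "finite F" "cvec.span F = (UNIV :: 'b set)" for F
    using inj[OF that(1)] image to_endo_surj[OF that] unfolding bij_betw_def by blast
  have \<omega>_J: "?\<omega> x = 0" "?\<omega>' x = 0" if "x \<in> \<J>" for x
    using vanish[OF clinear_Tr that] vanish[OF clinear_psi[OF \<tau>_linear] that] Tr psi that J_subset_I by auto
  have lin: "linear_on BDB_space to_endo"
    by (rule linear_on_mono[OF clinear_to_endo subset_UNIV])
  show ?thesis
    unfolding I_def J_def \<omega>_def \<omega>'_def BDB_def DEnd_def
    by (intro conjI ballI exI[of _ \<Phi>] exI[of _ to_endo] exI[of _ "\<lambda>x. to_endo (X x)"] ideal \<omega>_J quot lin image)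
      (use inj bij Tr psi in \<open>auto simp: \<Phi>_coset X_incl X_sandwich to_endo_pure\<close>)
qed

end
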